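(* Let $\widehat A = \widehat A \{ \Sigma_+ , C_+ , \Sigma_- , C_- \}$, where $\Sigma_\pm$ satisfy $\int(1+t^2)^{-1}d\Sigma_\pm<\infty$, $\int d\Sigma_\pm=\infty$, $\Sigma_\pm(t)=\frac12(\Sigma_\pm(t-0)+\Sigma_\pm(t+0))$, $\Sigma_\pm(0)=0$, and $C_\pm$ are arbitrary real constants. Let $\Phi := M_{\Sigma_+,C_+} - M_{\Sigma_-,C_-}$. Then: 1) If $\lambda \in \mathfrak{A}_0 (\Sigma_+) \cup \mathfrak{A}_0 (\Sigma_-)$, then $ \lambda \not \in \sigma_p (\widehat A)$. 2) If $\lambda \in \mathfrak{A}_p (\Sigma_+) \cap \mathfrak{A}_p (\Sigma_-)$, then (i) $\lambda$ is an eigenvalue of geometric multiplicity 1; (ii) $\lambda$ is simple iff at least one of $d\Sigma_- (\{ \lambda \} ) = d\Sigma_+ ( \{ \lambda \} )$, $\int_{\mathbb R \setminus \{\lambda \}} |t-\lambda |^{-2} d \Sigma_+ (t) < \infty$, $\int_{\mathbb R \setminus \{\lambda \}} |t-\lambda |^{-2} d \Sigma_- (t) < \infty$ fails; (iii) if these three hold, the algebraic multiplicity of $\lambda$ is the greatest $k\in\{2,3,\dots\}\cup\{+\infty\}$ such that \[ \int_{\mathbb R \setminus \{\lambda \}} \frac{d \Sigma_\pm (t)}{|t-\lambda|^{2j}} < \infty \quad\text{and}\quad \lim_{\varepsilon \to 0,\ \varepsilon \in \mathbb R} \Phi^{(j-2)} (\lambda+i\varepsilon) = 0 \] for all $2 \leq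 j \leq k-1$ (in particular $k=2$ if one of these fails for $j=2$). 3) If $\lambda \in \mathfrak{A}_r (\Sigma_+) \cap \mathfrak{A}_r (\Sigma_-)$, then $\lambda \in \sigma_p (\widehat A)$ iff $\lim_{\varepsilon \to 0} \Phi (\lambda+i\varepsilon) = 0$. In this case the geometric multiplicity is 1 and the algebraic multiplicity is the greatest $k$ ($1 \leq k \leq \infty$) such that $\int_{\mathbb R} |t-\lambda |^{-2j} d \Sigma_\pm (t) < \infty$ and $\lim_{\varepsilon \to 0} \Phi^{(j-1)} (\lambda+i\varepsilon) = 0$ for all $1 \leq j \leq k$. 4) If $\lambda \in \mathfrak{A}_p (\Sigma_+) \cap \mathfrak{A}_r (\Sigma_-)$ or $\lambda \in \mathfrak{A}_p (\Sigma_-) \cap \mathfrak{A}_r (\Sigma_+)$, then $\lambda \not \in \sigma_p (\widehat A)$.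
   Context: $Q_\Sigma$ is multiplication by $t$ in $L^2(\mathbb R,d\Sigma)$; $\sigma_c(S):=\{\lambda\notin\sigma_p(S): \operatorname{ran}(S-\lambda)\ne\overline{\operatorname{ran}(S-\lambda)}=H\}$. $\mathfrak A_0(\Sigma)=\{\lambda\in\sigma_c(Q_\Sigma):\int|t-\lambda|^{-2}d\Sigma=\infty\}$, $\mathfrak A_r(\Sigma)=\{\lambda\notin\sigma_p(Q_\Sigma):\int|t-\lambda|^{-2}d\Sigma<\infty\}$, $\mathfrak A_p(\Sigma)=\sigma_p(Q_\Sigma)$; $d\Sigma(\{\lambda\})=\Sigma(\lambda+0)-\Sigma(\lambda-0)$. $M_{\Sigma,C}(\lambda)=C+\int\big((t-\lambda)^{-1}-t(1+t^2)^{-1}\big)d\Sigma(t)$. $T_\Sigma^*$ has domain $\{f=f_Q+\mathfrak c\,t(t^2+1)^{-1}: f_Q\in\operatorname{dom}(Q_\Sigma)\}$, $T_\Sigma^*f=tf_Q-\mathfrak c(t^2+1)^{-1}$, $\Gamma_0^\Sigma f=\mathfrak c$, $\Gamma_1^{\Sigma,C}f=\mathfrak cC+\int f_Q d\Sigma$; $\widehat A\{\Sigma_+,C_+,\Sigma_-,C_-\}$ is the restriction of $T_{\Sigma_+}^*\oplus T_{\Sigma_-}^*$ in $L^2(d\Sigma_+)\oplus L^2(d\Sigma_-)$ to $\{f_++f_-:\Gamma_0^{\Sigma_+}f_+=\Gamma_0^{\Sigma_-}f_-,\ \Gamma_1^{\Sigma_+,C_+}f_+=\Gamma_1^{\Sigma_-,C_-}f_-\}$.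 *)

theory Defs
  imports "HOL-Analysis.Analysis" "HOL-Library.Extended_Nat"
begin

definition rlim :: "(real \<Rightarrow> real) \<Rightarrow> real \<Rightarrow> real" where
  "rlim S x = Lim (at_right x) S"

definition llim :: "(real \<Rightarrow> real) \<Rightarrow> real \<Rightarrow> real" where
  "llim S x = Lim (at_left x) S"

definition dS :: "(real \<Rightarrow> real) \<Rightarrow> real measure" where
  "dS S = interval_measure (rlim S)"

(* d Sigma({x}) = Sigma(x+0) - Sigma(x-0) *)
definition jump :: "(real \<Rightarrow> real) \<Rightarrow> real \<Rightarrow> real" where
  "jump S x = rlim S x - llim S x"

definition admissible :: "(real \<Rightarrow> real) \<Rightarrow> bool" where
  "admissible S \<longleftrightarrow> mono S
     \<and> (\<integral>\<^sup>+ t. ennreal (1 / (1 + t\<^sup>2)) \<partial>dS S) < \<infinity>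
     \<and> emeasure (dS S) UNIV = \<infinity>
     \<and> (\<forall>t. S t = (llim S t + rlim S t) / 2)
     \<and> S 0 = 0"

section \<open>L^2(d Sigma) with elements represented by functions (modulo a.e. equality)\<close>

definition L2 :: "real measure \<Rightarrow> (real \<Rightarrow> complex) \<Rightarrow> bool" where
  "L2 M f \<longleftrightarrow> f \<in> borel_measurable M \<and> integrable M (\<lambda>t. (cmod (f t))\<^sup>2)"

definition null :: "real measure \<Rightarrow> (real \<Rightarrow> complex) \<Rightarrow> bool" where
  "null M f \<longleftrightarrow> (AE t in M. f t = 0)"

definition domQ :: "real measure \<Rightarrow> (real \<Rightarrow> complex) \<Rightarrow> bool" where
  "domQ M f \<longleftrightarrow> L2 M f \<and> L2 M (\<lambda>t. complex_of_real t * f t)"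

definition sigma_p_Q :: "(real \<Rightarrow> real) \<Rightarrow> complex set" where
  "sigma_p_Q S = {lam. \<exists>f. domQ (dS S) f \<and> \<not> null (dS S) f
                      \<and> null (dS S) (\<lambda>t. (complex_of_real t - lam) * f t)}"

definition in_ran_Q :: "(real \<Rightarrow> real) \<Rightarrow> complex \<Rightarrow> (real \<Rightarrow> complex) \<Rightarrow> bool" where
  "in_ran_Q S lam g \<longleftrightarrow> (\<exists>f. domQ (dS S) f
        \<and> null (dS S) (\<lambda>t. (complex_of_real t - lam) * f t - g t))"

definition ran_dense_Q :: "(real \<Rightarrow> real) \<Rightarrow> complex \<Rightarrow> bool" where
  "ran_dense_Q S lam \<longleftrightarrow> (\<forall>g. L2 (dS S) g \<longrightarrow> (\<forall>e>0. \<exists>f. domQ (dS S) f \<and>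
        (\<integral>t. (cmod ((complex_of_real t - lam) * f t - g t))\<^sup>2 \<partial>dS S) < e))"

definition sigma_c_Q :: "(real \<Rightarrow> real) \<Rightarrow> complex set" where
  "sigma_c_Q S = {lam. lam \<notin> sigma_p_Q S \<and> ran_dense_Q S lam
                      \<and> (\<exists>g. L2 (dS S) g \<and> \<not> in_ran_Q S lam g)}"

definition negmom :: "(real \<Rightarrow> real) \<Rightarrow> complex \<Rightarrow> nat \<Rightarrow> ennreal" where
  "negmom S lam j = (\<integral>\<^sup>+ t. inverse (ennreal (cmod (complex_of_real t - lam))) ^ (2*j) \<partial>dS S)"

definition negmom' :: "(real \<Rightarrow> real) \<Rightarrow> complex \<Rightarrow> nat \<Rightarrow> ennreal" where
  "negmom' S lam j = (\<integral>\<^sup>+ t. indicator {t. complex_of_real t \<noteq> lam} t *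
                       inverse (ennreal (cmod (complex_of_real t - lam))) ^ (2*j) \<partial>dS S)"

definition A0 :: "(real \<Rightarrow> real) \<Rightarrow> complex set" where
  "A0 S = {lam. lam \<in> sigma_c_Q S \<and> negmom S lam 1 = \<infinity>}"

definition Ar :: "(real \<Rightarrow> real) \<Rightarrow> complex set" where
  "Ar S = {lam. lam \<notin> sigma_p_Q S \<and> negmom S lam 1 < \<infinity>}"

definition Ap :: "(real \<Rightarrow> real) \<Rightarrow> complex set" where
  "Ap S = sigma_p_Q S"

definition M_fun :: "(real \<Rightarrow> real) \<Rightarrow> real \<Rightarrow> complex \<Rightarrow> complex" where
  "M_fun S C z = complex_of_real C +
     (\<integral>t. (inverse (complex_of_real t - z) - complex_of_real (t / (1 + t\<^sup>2))) \<partial>dS S)"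

type_synonym hvec = "(real \<Rightarrow> complex) \<times> (real \<Rightarrow> complex)"

(* f \<in> dom(T_Sigma^* ), f = f_Q + c t/(t^2+1) with f_Q \<in> dom(Q_Sigma) *)
definition Tdecomp :: "real measure \<Rightarrow> (real \<Rightarrow> complex) \<Rightarrow> complex \<Rightarrow> (real \<Rightarrow> complex) \<Rightarrow> bool" where
  "Tdecomp M f c fQ \<longleftrightarrow> domQ M fQ \<and>
     (AE t in M. f t = fQ t + c * complex_of_real (t / (t\<^sup>2 + 1)))"

definition Gamma1 :: "real measure \<Rightarrow> real \<Rightarrow> complex \<Rightarrow> (real \<Rightarrow> complex) \<Rightarrow> complex" where
  "Gamma1 M C c fQ = c * complex_of_real C + (\<integral>t. fQ t \<partial>M)"

(* graph of A-hat: Ahat ... x y  means  x \<in> dom(A-hat) and A-hat x = y (in H) *)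
definition Ahat :: "(real \<Rightarrow> real) \<Rightarrow> real \<Rightarrow> (real \<Rightarrow> real) \<Rightarrow> real \<Rightarrow> hvec \<Rightarrow> hvec \<Rightarrow> bool" where
  "Ahat Sp Cp Sm Cm x y \<longleftrightarrow>
     (\<exists>c fQp fQm.
        Tdecomp (dS Sp) (fst x) c fQp \<and> Tdecomp (dS Sm) (snd x) c fQm \<and>
        Gamma1 (dS Sp) Cp c fQp = Gamma1 (dS Sm) Cm c fQm \<and>
        (AE t in dS Sp. fst y t = complex_of_real t * fQp t - c * complex_of_real (1 / (t\<^sup>2 + 1))) \<and>
        (AE t in dS Sm. snd y t = complex_of_real t * fQm t - c * complex_of_real (1 / (t\<^sup>2 + 1))))"

definition Hvec :: "(real \<Rightarrow> real) \<Rightarrow> (real \<Rightarrow> real) \<Rightarrow> hvec \<Rightarrow> bool" where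
  "Hvec Sp Sm x \<longleftrightarrow> L2 (dS Sp) (fst x) \<and> L2 (dS Sm) (snd x)"

definition Hzero :: "(real \<Rightarrow> real) \<Rightarrow> (real \<Rightarrow> real) \<Rightarrow> hvec \<Rightarrow> bool" where
  "Hzero Sp Sm x \<longleftrightarrow> null (dS Sp) (fst x) \<and> null (dS Sm) (snd x)"

definition Hscale :: "complex \<Rightarrow> hvec \<Rightarrow> hvec" where
  "Hscale a x = ((\<lambda>t. a * fst x t), (\<lambda>t. a * snd x t))"

definition Hadd :: "hvec \<Rightarrow> hvec \<Rightarrow> hvec" where
  "Hadd x y = ((\<lambda>t. fst x t + fst y t), (\<lambda>t. snd x t + snd y t))"

definition Hdiff :: "hvec \<Rightarrow> hvec \<Rightarrow> hvec" where
  "Hdiff x y = ((\<lambda>t. fst x t - fst y t), (\<lambda>t. snd x t - snd y t))"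

definition Ashift :: "(real \<Rightarrow> real) \<Rightarrow> real \<Rightarrow> (real \<Rightarrow> real) \<Rightarrow> real \<Rightarrow> complex \<Rightarrow> hvec \<Rightarrow> hvec \<Rightarrow> bool" where
  "Ashift Sp Cp Sm Cm lam x y \<longleftrightarrow>
     (\<exists>z. Ahat Sp Cp Sm Cm x z \<and> Hzero Sp Sm (Hdiff y (Hdiff z (Hscale lam x))))"

definition eigvec :: "(real \<Rightarrow> real) \<Rightarrow> real \<Rightarrow> (real \<Rightarrow> real) \<Rightarrow> real \<Rightarrow> complex \<Rightarrow> hvec \<Rightarrow> bool" where
  "eigvec Sp Cp Sm Cm lam x \<longleftrightarrow> Hvec Sp Sm x \<and> (\<exists>y. Ashift Sp Cp Sm Cm lam x y \<and> Hzero Sp Sm y)"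

definition rootvec :: "(real \<Rightarrow> real) \<Rightarrow> real \<Rightarrow> (real \<Rightarrow> real) \<Rightarrow> real \<Rightarrow> complex \<Rightarrow> hvec \<Rightarrow> bool" where
  "rootvec Sp Cp Sm Cm lam x \<longleftrightarrow> Hvec Sp Sm x \<and>
     (\<exists>n y. (Ashift Sp Cp Sm Cm lam ^^ n) x y \<and> Hzero Sp Sm y)"

definition Hlin_indep :: "(real \<Rightarrow> real) \<Rightarrow> (real \<Rightarrow> real) \<Rightarrow> hvec list \<Rightarrow> bool" where
  "Hlin_indep Sp Sm xs \<longleftrightarrow> (\<forall>a :: nat \<Rightarrow> complex.
     Hzero Sp Sm (fold Hadd (map (\<lambda>i. Hscale (a i) (xs ! i)) [0..<length xs]) (\<lambda>_. 0, \<lambda>_. 0))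
       \<longrightarrow> (\<forall>i<length xs. a i = 0))"

definition Hdim :: "(real \<Rightarrow> real) \<Rightarrow> (real \<Rightarrow> real) \<Rightarrow> (hvec \<Rightarrow> bool) \<Rightarrow> enat" where
  "Hdim Sp Sm P = Sup {enat (length xs) | xs. (\<forall>x\<in>set xs. P x) \<and> Hlin_indep Sp Sm xs}"

definition sigma_p_Ahat :: "(real \<Rightarrow> real) \<Rightarrow> real \<Rightarrow> (real \<Rightarrow> real) \<Rightarrow> real \<Rightarrow> complex set" where
  "sigma_p_Ahat Sp Cp Sm Cm = {lam. \<exists>x. eigvec Sp Cp Sm Cm lam x \<and> \<not> Hzero Sp Sm x}"

definition geom_mult :: "(real \<Rightarrow> real) \<Rightarrow> real \<Rightarrow> (real \<Rightarrow> real) \<Rightarrow> real \<Rightarrow> complex \<Rightarrow> enat" where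
  "geom_mult Sp Cp Sm Cm lam = Hdim Sp Sm (eigvec Sp Cp Sm Cm lam)"

definition alg_mult :: "(real \<Rightarrow> real) \<Rightarrow> real \<Rightarrow> (real \<Rightarrow> real) \<Rightarrow> real \<Rightarrow> complex \<Rightarrow> enat" where
  "alg_mult Sp Cp Sm Cm lam = Hdim Sp Sm (rootvec Sp Cp Sm Cm lam)"

definition simple_eig :: "(real \<Rightarrow> real) \<Rightarrow> real \<Rightarrow> (real \<Rightarrow> real) \<Rightarrow> real \<Rightarrow> complex \<Rightarrow> bool" where
  "simple_eig Sp Cp Sm Cm lam \<longleftrightarrow> lam \<in> sigma_p_Ahat Sp Cp Sm Cm \<and> alg_mult Sp Cp Sm Cm lam = 1"

definition vlim0 :: "(complex \<Rightarrow> complex) \<Rightarrow> complex \<Rightarrow> bool" where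
  "vlim0 F lam \<longleftrightarrow> ((\<lambda>e::real. F (lam + \<i> * complex_of_real e)) \<longlongrightarrow> 0) (at 0)"

end

theory Submission
  imports Defs
begin

text \<open>On \<open>dom T*\<close> the operator \<open>T* - \<lambda>\<close> acts as \<open>f \<mapsto> (t - \<lambda>) f - c\<close> with \<open>c = \<Gamma>\<^sub>0 f\<close>, so a root
  vector of \<open>A\<close> at \<open>\<lambda>\<close> is, in both components, a polynomial in \<open>1 / (t - \<lambda>)\<close> without constant
  term, the same one on either side, plus a point mass at \<open>\<lambda>\<close>. Square integrability of the leading
  term gives the moment conditions, and the coupling of the \<open>\<Gamma>\<^sub>1\<close> says that a combination of the
  moments \<open>\<integral> (t - \<lambda>)\<^sup>-\<^sup>j\<close> of \<open>d\<Sigma>\<^sub>+ - d\<Sigma>\<^sub>-\<close> vanishes; by dominated convergence these are the boundary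
  values of the derivatives of \<open>\<Phi>\<close>, up to factorials and to the contributions of the atoms, which
  cancel. If \<open>\<lambda>\<close> is an atom of both measures, evaluating \<open>(t - \<lambda>) f = c + \<dots>\<close> at \<open>t = \<lambda>\<close> forces
  the two point masses to agree, and this delays every condition by one step.\<close>

section \<open>Jumps of monotone functions\<close>

text \<open>Sufficiency of the conditions is a matter of exhibiting chains. The delicate point is
  that nothing else is a root vector. \<open>Ashift\<close> is a relation between functions modulo
  null sets, so the argument describes preimages: a preimage of a combination of length n is one of
  length n + 1. Any family of combinations that is closed under preimages then contains all root
  vectors, and closure amounts to the vanishing of one top coefficient. At a common atom the
  coupling can tolerate one nonzero moment \<open>Psi m\<close>, because unequal point masses on the
  two sides compensate for it. Only the next preimage requires equal masses and hence
  \<open>Psi m = 0\<close>. This is why the count starts at 2 and why the condition on the moment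
  with index j + 2 is paired with the derivative of order j. Infinite total mass gives linear
  independence: a nontrivial polynomial in 1 / (t - \<lambda>) vanishes on a finite set only, and
  finite sets have finite mass. Nonreal \<lambda> needs no separate treatment, since there
  \<open>pt\<close> vanishes and every moment exists. Derivatives of \<Phi> are evaluated off the
  real axis only, where differentiation under the integral is legitimate.\<close>

lemma mono_tendsto_right:
  fixes F :: "real \<Rightarrow> real"
  assumes "mono F"
  shows "(F \<longlongrightarrow> Inf (F ` {x<..})) (at_right x)"
proof (rule order_tendstoI)
  have bdd: "bdd_below (F ` {x<..})"
    by (rule bdd_belowI[of _ "F x"]) (auto intro: monoD[OF assms])
  fix a
  { assume "a < Inf (F ` {x<..})"
    then have "a < F y" if "x < y" for y
      using cInf_lower[OF _ bdd, of "F y"] that by auto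
    then show "\<forall>\<^sub>F y in at_right x. a < F y"
      by (auto simp: eventually_at_right_field intro: exI[of _ "x + 1"]) }
  { assume "Inf (F ` {x<..}) < a"
    then obtain b where "x < b" "F b < a"
      using cInf_less_iff[OF _ bdd, of a] by auto
    then have "F y < a" if "y < b" for y
      using monoD[OF assms, of y b] that by linarith
    then show "\<forall>\<^sub>F y in at_right x. F y < a"
      using \<open>x < b\<close> by (auto simp: eventually_at_right_field) }
qed

lemma mono_tendsto_left:
  fixes F :: "real \<Rightarrow> real"
  assumes "mono F"
  shows "(F \<longlongrightarrow> Sup (F ` {..<x})) (at_left x)"
proof (rule order_tendstoI)
  have bdd: "bdd_above (F ` {..<x})"
    by (rule bdd_aboveI[of _ "F x"]) (auto intro: monoD[OF assms])
  fix a
  { assume "Sup (F ` {..<x}) < a"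
    then have "F y < a" if "y < x" for y
      using cSup_upper[OF _ bdd, of "F y"] that by auto
    then show "\<forall>\<^sub>F y in at_left x. F y < a"
      by (auto simp: eventually_at_left_field intro: exI[of _ "x - 1"]) }
  { assume "a < Sup (F ` {..<x})"
    then obtain b where "b < x" "a < F b"
      using less_cSup_iff[OF _ bdd, of a] by auto
    then have "a < F y" if "b < y" for y
      using monoD[OF assms, of b y] that by linarith
    then show "\<forall>\<^sub>F y in at_left x. a < F y"
      using \<open>b < x\<close> by (auto simp: eventually_at_left_field) }
qed

context
  fixes S :: "real \<Rightarrow> real"
  assumes mono_S: "mono S"
begin

lemma tendsto_rlim: "(S \<longlongrightarrow> rlim S x) (at_right x)"
  unfolding rlim_def using mono_tendsto_right[OF mono_S, of x] by (simp add: tendsto_Lim)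

lemma tendsto_llim: "(S \<longlongrightarrow> llim S x) (at_left x)"
  unfolding llim_def using mono_tendsto_left[OF mono_S, of x] by (simp add: tendsto_Lim)

lemma le_rlim: "S x \<le> rlim S x"
proof (rule tendsto_lowerbound[OF tendsto_rlim])
  show "\<forall>\<^sub>F y in at_right x. S x \<le> S y"
    unfolding eventually_at_right_field using monoD[OF mono_S, of x] by (auto intro: exI[of _ "x + 1"])
qed simp

lemma rlim_le: "x < y \<Longrightarrow> rlim S x \<le> S y"
proof (rule tendsto_upperbound[OF tendsto_rlim])
  assume "x < y"
  then show "\<forall>\<^sub>F w in at_right x. S w \<le> S y"
    unfolding eventually_at_right_field using monoD[OF mono_S, of _ y] by (auto intro: exI[of _ y])
qed simp

lemma mono_rlim: "x \<le> y \<Longrightarrow> rlim S x \<le> rlim S y"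
  using rlim_le[of x y] le_rlim[of y] by (cases "x = y") auto

lemma continuous_rlim: "continuous (at_right x) (rlim S)"
  unfolding continuous_within
proof (rule order_tendstoI)
  fix a
  { assume "a < rlim S x"
    then have "a < rlim S y" if "x < y" for y
      using mono_rlim[of x y] that by linarith
    then show "\<forall>\<^sub>F y in at_right x. a < rlim S y"
      by (auto simp: eventually_at_right_field intro: exI[of _ "x + 1"]) }
  { assume "rlim S x < a"
    then have "\<forall>\<^sub>F y in at_right x. S y < a"
      using tendsto_rlim by (auto dest: order_tendstoD)
    then obtain b where b: "x < b" "\<And>y. x < y \<Longrightarrow> y < b \<Longrightarrow> S y < a"
      by (auto simp: eventually_at_right_field)
    have "rlim S y < a" if "x < y" "y < b" for y
    proof -
      obtain w where "y < w" "w < b" using dense[OF \<open>y < b\<close>] by blast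
      then show ?thesis using rlim_le[of y w] b(2)[of w] that by auto
    qed
    then show "\<forall>\<^sub>F y in at_right x. rlim S y < a"
      using b(1) by (auto simp: eventually_at_right_field) }
qed

text \<open>The measure is generated by \<open>rlim S\<close>, whereas the jump involves the left
  limit of \<open>S\<close> itself. Along a strictly increasing sequence \<open>u\<close> with limit
  x, \<open>rlim S (u n)\<close> is squeezed between \<open>S (u n)\<close> and
  \<open>S (u (Suc n))\<close>, so both functions have the same left limit.\<close>

lemma measure_dS_singleton: "measure (dS S) {x} = jump S x"
proof -
  have Ioc: "emeasure (dS S) {a<..b} = ennreal (rlim S b - rlim S a)" if "a \<le> b" for a b
    unfolding dS_def by (rule emeasure_interval_measure_Ioc) (use that mono_rlim continuous_rlim in auto)
  define u where "u = (\<lambda>n::nat. x - inverse (real (Suc n)))"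
  have u: "u n < x" for n by (simp add: u_def)
  have u_inc: "u n < u (Suc n)" for n
    by (simp add: u_def field_simps)
  have u_lim: "u \<longlonglongrightarrow> x"
    unfolding u_def using LIMSEQ_inverse_real_of_nat_add_minus[of x] by simp
  have u_left: "filterlim u (at_left x) sequentially"
    unfolding filterlim_at using u_lim u by (auto simp: less_imp_neq)
  have lim1: "(\<lambda>n. S (u n)) \<longlonglongrightarrow> llim S x"
    using filterlim_compose[OF tendsto_llim u_left] .
  have "(\<lambda>n. rlim S (u n)) \<longlonglongrightarrow> llim S x"
  proof (rule tendsto_sandwich[OF _ _ lim1 LIMSEQ_Suc[OF lim1]])
    show "\<forall>\<^sub>F n in sequentially. S (u n) \<le> rlim S (u n)" by (simp add: le_rlim)
    show "\<forall>\<^sub>F n in sequentially. rlim S (u n) \<le> S (u (Suc n))" by (simp add: rlim_le u_inc)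
  qed
  then have A: "(\<lambda>n. ennreal (rlim S x - rlim S (u n))) \<longlonglongrightarrow> ennreal (jump S x)"
    unfolding jump_def by (intro tendsto_ennrealI tendsto_intros)
  have "(\<lambda>n. emeasure (dS S) {u n<..x}) \<longlonglongrightarrow> emeasure (dS S) (\<Inter>n. {u n<..x})"
  proof (rule Lim_emeasure_decseq)
    show "range (\<lambda>n. {u n<..x}) \<subseteq> sets (dS S)" by (auto simp: dS_def)
    show "decseq (\<lambda>n. {u n<..x})"
    proof (rule decseq_SucI)
      show "{u (Suc n)<..x} \<subseteq> {u n<..x}" for n using u_inc[of n] by auto
    qed
    show "emeasure (dS S) {u n<..x} \<noteq> \<infinity>" for n using Ioc[of "u n" x] u[of n] by simp
  qed
  moreover have "(\<Inter>n. {u n<..x}) = {x}"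
  proof (intro equalityI subsetI)
    fix y assume y: "y \<in> (\<Inter>n. {u n<..x})"
    then have "x \<le> y" by (intro LIMSEQ_le_const2[OF u_lim]) (auto intro: less_imp_le)
    then show "y \<in> {x}" using y by auto
  qed (use u in auto)
  ultimately have "(\<lambda>n. ennreal (rlim S x - rlim S (u n))) \<longlonglongrightarrow> emeasure (dS S) {x}"
    using Ioc u by (simp add: less_imp_le)
  then have "emeasure (dS S) {x} = ennreal (jump S x)" using A LIMSEQ_unique by blast
  moreover have "0 \<le> jump S x"
  proof -
    have "\<forall>\<^sub>F y in at_left x. S y \<le> S x"
      unfolding eventually_at_left_field using monoD[OF mono_S, of _ x] by (auto intro: exI[of _ "x - 1"])
    then have "llim S x \<le> S x" by (rule tendsto_upperbound[OF tendsto_llim]) simp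
    then show ?thesis using le_rlim[of x] by (simp add: jump_def)
  qed
  ultimately show ?thesis by (simp add: measure_def)
qed

end

section \<open>Square-integrable functions and powers of the resolvent kernel\<close>

lemma L2_add:
  assumes "L2 M f" "L2 M g"
  shows "L2 M (\<lambda>t. f t + g t)"
proof -
  have [measurable]: "f \<in> borel_measurable M" "g \<in> borel_measurable M"
    using assms by (auto simp: L2_def)
  have "integrable M (\<lambda>t. (cmod (f t + g t))\<^sup>2)"
  proof (rule Bochner_Integration.integrable_bound)
    show "integrable M (\<lambda>t. 2 * (cmod (f t))\<^sup>2 + 2 * (cmod (g t))\<^sup>2)"
      using assms by (auto simp: L2_def)
    have "(cmod (f t + g t))\<^sup>2 \<le> 2 * (cmod (f t))\<^sup>2 + 2 * (cmod (g t))\<^sup>2" for t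
    proof -
      have "(cmod (f t + g t))\<^sup>2 \<le> (cmod (f t) + cmod (g t))\<^sup>2"
        by (intro power_mono norm_triangle_ineq) auto
      also have "\<dots> \<le> 2 * (cmod (f t))\<^sup>2 + 2 * (cmod (g t))\<^sup>2"
        using sum_squares_bound[of "cmod (f t)" "cmod (g t)"] by (simp add: power2_sum)
      finally show ?thesis .
    qed
    then show "AE t in M. norm ((cmod (f t + g t))\<^sup>2)
        \<le> norm (2 * (cmod (f t))\<^sup>2 + 2 * (cmod (g t))\<^sup>2)" by auto
  qed measurable
  then show ?thesis by (auto simp: L2_def)
qed

lemma L2_scale: "L2 M f \<Longrightarrow> L2 M (\<lambda>t. a * f t)"
  by (auto simp: L2_def norm_mult power_mult_distrib)

lemma L2_diff: "L2 M f \<Longrightarrow> L2 M g \<Longrightarrow> L2 M (\<lambda>t. f t - g t)"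
  using L2_add[of M f "\<lambda>t. (-1) * g t"] L2_scale[of M g "-1"] by simp

lemma L2_zero: "L2 M (\<lambda>t. 0)"
  by (auto simp: L2_def)

lemma L2_sum: "(\<And>i. i \<in> A \<Longrightarrow> L2 M (f i)) \<Longrightarrow> L2 M (\<lambda>t. \<Sum>i\<in>A. f i t)"
  by (induction A rule: infinite_finite_induct) (auto intro: L2_zero L2_add)

lemma L2_cong_AE:
  assumes "L2 M f" "g \<in> borel_measurable M" "AE t in M. g t = f t"
  shows "L2 M g"
proof -
  have [measurable]: "f \<in> borel_measurable M" "g \<in> borel_measurable M"
    using assms by (auto simp: L2_def)
  have "integrable M (\<lambda>t. (cmod (g t))\<^sup>2) \<longleftrightarrow> integrable M (\<lambda>t. (cmod (f t))\<^sup>2)"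
    by (rule integrable_cong_AE) (use assms(3) in auto)
  then show ?thesis using assms by (auto simp: L2_def)
qed

lemma domQ_add: "domQ M f \<Longrightarrow> domQ M g \<Longrightarrow> domQ M (\<lambda>t. f t + g t)"
  using L2_add[of M f g] L2_add[of M "\<lambda>t. of_real t * f t" "\<lambda>t. of_real t * g t"]
  by (auto simp: domQ_def algebra_simps)

lemma domQ_scale: "domQ M f \<Longrightarrow> domQ M (\<lambda>t. a * f t)"
  using L2_scale[of M f a] L2_scale[of M "\<lambda>t. of_real t * f t" a]
  by (auto simp: domQ_def algebra_simps)

lemma domQ_zero: "domQ M (\<lambda>t. 0)"
  by (auto simp: domQ_def L2_zero)

lemma domQ_sum: "(\<And>i. i \<in> A \<Longrightarrow> domQ M (f i)) \<Longrightarrow> domQ M (\<lambda>t. \<Sum>i\<in>A. f i t)"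
  by (induction A rule: infinite_finite_induct) (auto intro: domQ_zero domQ_add)

text \<open>The value at \<open>t = z\<close> is \<open>0\<close>, since \<open>inverse 0 = 0\<close>; so every power of \<open>rk z\<close> is
  automatically restricted to \<open>\<real> - {z}\<close>.\<close>

definition rk :: "complex \<Rightarrow> real \<Rightarrow> complex" where
  "rk z t = inverse (complex_of_real t - z)"

definition pt :: "complex \<Rightarrow> real \<Rightarrow> complex" where
  "pt z t = (if complex_of_real t = z then 1 else 0)"

definition atom :: "real measure \<Rightarrow> complex \<Rightarrow> real" where
  "atom M z = measure M {t. complex_of_real t = z}"

definition pol :: "complex \<Rightarrow> complex \<Rightarrow> (nat \<Rightarrow> complex) \<Rightarrow> nat \<Rightarrow> real \<Rightarrow> complex" where
  "pol z s b n t = s * pt z t + (\<Sum>i<n. b i * rk z t ^ Suc i)"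

text \<open>Up to the atom at \<open>z\<close>, this is the \<open>i\<close>-th Taylor coefficient of \<open>M_fun\<close> at \<open>z\<close>, understood as
  a boundary value when \<open>z\<close> is real.\<close>

definition mom :: "real measure \<Rightarrow> real \<Rightarrow> complex \<Rightarrow> nat \<Rightarrow> complex" where
  "mom M C z i = (if i = 0
     then complex_of_real C + (\<integral>t. (rk z t - complex_of_real (t / (1 + t\<^sup>2))) \<partial>M)
     else (\<integral>t. rk z t ^ Suc i \<partial>M))"

lemma measurable_rk [measurable]: "rk z \<in> borel_measurable borel"
  unfolding rk_def by measurable

lemma measurable_pt [measurable]: "pt z \<in> borel_measurable borel"
  unfolding pt_def by measurable

lemma measurable_pol [measurable]: "pol z s b n \<in> borel_measurable borel"
  unfolding pol_def by measurable

lemma pt_mult: "(complex_of_real t - z) * pt z t = 0"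
  by (auto simp: pt_def)

lemma mult_rk: "(complex_of_real t - z) * rk z t = 1 - pt z t"
  by (auto simp: rk_def pt_def)

lemma mult_rk_power: "(complex_of_real t - z) * rk z t ^ Suc (Suc i) = rk z t ^ Suc i"
  by (cases "complex_of_real t = z") (auto simp: rk_def)

text \<open>At distance a \<ge> d from z both 1 and |t| are bounded by multiples of a, namely a / d
  and a (1 + |z| / d). Hence 1 + t^2 is at most \<open>K\<close> a^2 with \<open>K\<close> the sum
  of the squared factors, and the remaining 2 j powers of 1 / a are at most powers of 1 / d.\<close>

lemma rk_power_bound:
  assumes "d > 0"
  shows "\<exists>C\<ge>0. \<forall>t. d \<le> cmod (complex_of_real t - z) \<longrightarrow> cmod (rk z t) ^ (2 * Suc j) \<le> C / (1 + t\<^sup>2)"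
proof -
  define K where "K = 1 / d\<^sup>2 + (1 + cmod z / d)\<^sup>2"
  have K: "K \<ge> 0" unfolding K_def by simp
  have "cmod (rk z t) ^ (2 * Suc j) \<le> ((1 / d) ^ (2 * j) * K) / (1 + t\<^sup>2)"
    if t: "d \<le> cmod (complex_of_real t - z)" for t
  proof -
    define a where "a = cmod (complex_of_real t - z)"
    have a: "a > 0" "d \<le> a" using t assms by (auto simp: a_def)
    have rk: "cmod (rk z t) = 1 / a" by (simp add: rk_def a_def norm_inverse divide_inverse)
    have "\<bar>t\<bar> = cmod ((complex_of_real t - z) + z)" by simp
    also have "\<dots> \<le> a + cmod z" unfolding a_def by (rule norm_triangle_ineq)
    also have "\<dots> \<le> a + cmod z * (a / d)"
      using a assms mult_left_mono[of 1 "a/d" "cmod z"] by simp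
    finally have "\<bar>t\<bar> \<le> a * (1 + cmod z / d)" by (simp add: algebra_simps)
    then have "t\<^sup>2 \<le> (a * (1 + cmod z / d))\<^sup>2" by (metis abs_ge_zero power2_abs power_mono)
    moreover have "1 \<le> a\<^sup>2 * (1 / d\<^sup>2)"
      using a assms by (simp add: field_simps power_mono)
    moreover have "a\<^sup>2 * K = a\<^sup>2 * (1 / d\<^sup>2) + (a * (1 + cmod z / d))\<^sup>2"
      unfolding K_def power_mult_distrib by (rule distrib_left)
    ultimately have "1 + t\<^sup>2 \<le> a\<^sup>2 * K" by linarith
    then have "(1 / a)\<^sup>2 \<le> K / (1 + t\<^sup>2)"
      using a by (simp add: field_simps power_divide add_pos_nonneg)
    moreover have "(1 / a) ^ (2 * j) \<le> (1 / d) ^ (2 * j)"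
      using a assms by (intro power_mono) (auto simp: field_simps)
    ultimately have "(1 / a) ^ (2 * j) * (1 / a)\<^sup>2 \<le> (1 / d) ^ (2 * j) * (K / (1 + t\<^sup>2))"
      using K by (intro mult_mono) auto
    then show ?thesis unfolding rk by (simp add: power_add[symmetric] mult.assoc power2_eq_square)
  qed
  then show ?thesis using K assms
    by (intro exI[of _ "(1 / d) ^ (2 * j) * K"]) auto
qed

section \<open>Measures that integrate 1 / (1 + t^2): square integrability and the domain of
  Q\<close>

locale weighted_measure =
  fixes M :: "real measure"
  assumes sets_M [measurable_cong, simp]: "sets M = sets borel"
    and weight_finite: "(\<integral>\<^sup>+ t. ennreal (1 / (1 + t\<^sup>2)) \<partial>M) < \<infinity>"
begin

lemma space_M [simp]: "space M = UNIV"
  using sets_eq_imp_space_eq[OF sets_M] by simp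

lemma integrable_weight: "integrable M (\<lambda>t. 1 / (1 + t\<^sup>2))"
  using weight_finite by (intro integrableI_nonneg) (auto simp: add_nonneg_nonneg)

lemma L2_weight: "L2 M (\<lambda>t. complex_of_real (1 / (1 + t\<^sup>2)))"
proof -
  have "integrable M (\<lambda>t. (cmod (complex_of_real (1 / (1 + t\<^sup>2))))\<^sup>2)"
  proof (rule Bochner_Integration.integrable_bound[OF integrable_weight])
    have "(1 / (1 + t\<^sup>2))\<^sup>2 \<le> 1 / (1 + t\<^sup>2)" for t :: real
      using power_decreasing[of 1 2 "1 / (1 + t\<^sup>2)"] by (simp add: add_pos_nonneg)
    then show "AE t in M. norm ((cmod (complex_of_real (1 / (1 + t\<^sup>2))))\<^sup>2) \<le> norm (1 / (1 + t\<^sup>2))"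
      by (simp only: norm_of_real real_norm_def power2_abs abs_power2) (auto intro: order_trans[OF _ abs_ge_self])
  qed measurable
  then show ?thesis unfolding L2_def by simp
qed

lemma L2_weight_t: "L2 M (\<lambda>t. complex_of_real (t / (1 + t\<^sup>2)))"
proof -
  have "integrable M (\<lambda>t. (cmod (complex_of_real (t / (1 + t\<^sup>2))))\<^sup>2)"
  proof (rule Bochner_Integration.integrable_bound[OF integrable_weight])
    have "(t / (1 + t\<^sup>2))\<^sup>2 \<le> 1 / (1 + t\<^sup>2)" for t :: real
    proof -
      have p: "1 + t\<^sup>2 > 0" by (simp add: add_pos_nonneg)
      have "(t / (1 + t\<^sup>2))\<^sup>2 = (t\<^sup>2 / (1 + t\<^sup>2)) * (1 / (1 + t\<^sup>2))"
        by (simp add: power_divide power2_eq_square)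
      also have "\<dots> \<le> 1 * (1 / (1 + t\<^sup>2))"
        using p by (intro mult_right_mono) auto
      finally show ?thesis by simp
    qed
    then show "AE t in M. norm ((cmod (complex_of_real (t / (1 + t\<^sup>2))))\<^sup>2) \<le> norm (1 / (1 + t\<^sup>2))"
      by (simp only: norm_of_real real_norm_def power2_abs abs_power2) (auto intro: order_trans[OF _ abs_ge_self])
  qed measurable
  then show ?thesis unfolding L2_def by simp
qed

text \<open>This gives a meaning to the integral in \<open>\<Gamma>\<^sub>1\<close>. The square of
  |f| is the product of u = (1 + t^2) |f|^2 and v = 1 / (1 + t^2), both integrable, so |f| is at
  most u + v.\<close>

lemma domQ_imp_integrable:
  assumes "domQ M f"
  shows "integrable M f"
proof (rule Bochner_Integration.integrable_bound)
  show [measurable]: "f \<in> borel_measurable M" using assms by (auto simp: domQ_def L2_def)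
  show "integrable M (\<lambda>t. (cmod (f t))\<^sup>2 + (cmod (complex_of_real t * f t))\<^sup>2 + 1 / (1 + t\<^sup>2))"
    using assms integrable_weight by (auto simp: domQ_def L2_def)
  have "cmod (f t) \<le> (cmod (f t))\<^sup>2 + (cmod (complex_of_real t * f t))\<^sup>2 + 1 / (1 + t\<^sup>2)" for t
  proof -
    define u where "u = (1 + t\<^sup>2) * (cmod (f t))\<^sup>2"
    define v where "v = 1 / (1 + t\<^sup>2)"
    have p: "1 + t\<^sup>2 > 0" by (simp add: add_pos_nonneg)
    have nn: "u \<ge> 0" "v \<ge> 0" using p by (auto simp: u_def v_def)
    have "(cmod (f t))\<^sup>2 = u * v" using p by (simp add: u_def v_def)
    also have "\<dots> \<le> (u + v)\<^sup>2" using nn by (simp add: power2_sum)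
    finally have "cmod (f t) \<le> u + v" using nn by (simp add: power2_le_iff_abs_le)
    then show ?thesis by (simp add: u_def v_def norm_mult power_mult_distrib algebra_simps)
  qed
  then show "AE t in M. norm (f t)
      \<le> norm ((cmod (f t))\<^sup>2 + (cmod (complex_of_real t * f t))\<^sup>2 + 1 / (1 + t\<^sup>2))"
    by (auto intro: order_trans[OF _ abs_ge_self])
qed

lemma finite_atom: "emeasure M {t. complex_of_real t = z} < \<infinity>"
proof -
  have "emeasure M {t. complex_of_real t = z}
      = (\<integral>\<^sup>+ t. indicator {t. complex_of_real t = z} t \<partial>M)"
    by (subst nn_integral_indicator) auto
  \<comment> \<open>The set is empty or the single point \<open>Re z\<close>, where the factor 1 +
    (Re z)^2 turns the weight into 1.\<close>
  also have "\<dots> \<le> (\<integral>\<^sup>+ t. ennreal (1 + (Re z)\<^sup>2) * ennreal (1 / (1 + t\<^sup>2)) \<partial>M)"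
  proof (intro nn_integral_mono)
    fix t
    show "indicator {t. complex_of_real t = z} t \<le> ennreal (1 + (Re z)\<^sup>2) * ennreal (1 / (1 + t\<^sup>2))"
    proof (cases "complex_of_real t = z")
      case True
      then have "Re z = t" by auto
      moreover have "1 + t\<^sup>2 \<noteq> 0" by (metis add_pos_nonneg less_numeral_extra(1,3) zero_le_power2)
      ultimately have "(1 + (Re z)\<^sup>2) * (1 / (1 + t\<^sup>2)) = 1" by simp
      then have "ennreal (1 + (Re z)\<^sup>2) * ennreal (1 / (1 + t\<^sup>2)) = 1"
        by (subst ennreal_mult''[symmetric]) (auto simp: add_nonneg_nonneg)
      then show ?thesis by (simp add: indicator_def)
    qed auto
  qed
  also have "\<dots> = ennreal (1 + (Re z)\<^sup>2) * (\<integral>\<^sup>+ t. ennreal (1 / (1 + t\<^sup>2)) \<partial>M)"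
    by (rule nn_integral_cmult) measurable
  also have "\<dots> < \<infinity>" using weight_finite by (simp add: ennreal_mult_less_top)
  finally show ?thesis .
qed

lemma emeasure_atom: "emeasure M {t. complex_of_real t = z} = ennreal (atom M z)"
  unfolding atom_def using finite_atom[of z] by (intro emeasure_eq_ennreal_measure) auto

lemma atom_nonneg: "atom M z \<ge> 0"
  by (simp add: atom_def)

lemma AE_pt_zero: "atom M z = 0 \<Longrightarrow> AE t in M. pt z t = 0"
proof -
  assume "atom M z = 0"
  then have "{t. complex_of_real t = z} \<in> null_sets M"
    by (auto simp: null_sets_def emeasure_atom)
  then show ?thesis by (rule AE_I') (auto simp: pt_def)
qed

text \<open>A point of positive mass lies in no exceptional null set, so a.e. identities may be
  evaluated there. A nonzero atom also forces z to be real.\<close>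

lemma AE_atomD:
  assumes "AE t in M. P t" "atom M z \<noteq> 0"
  shows "complex_of_real (Re z) = z \<and> P (Re z)"
proof -
  have *: "\<exists>t. complex_of_real t = z \<and> P t"
  proof (rule ccontr)
    assume "\<not> ?thesis"
    then have "AE t in M. t \<notin> {t. complex_of_real t = z}" using assms(1) by auto
    then have "emeasure M {t. complex_of_real t = z} = 0"
      by (subst (asm) AE_iff_null) (auto simp: null_sets_def)
    then show False using assms(2) by (simp add: emeasure_atom atom_nonneg ennreal_eq_0_iff order.antisym)
  qed
  then show ?thesis by auto
qed

lemma L2_pt: "L2 M (pt z)"
proof -
  have "integrable M (\<lambda>t. indicator {t. complex_of_real t = z} t :: real)"
    by (rule integrable_real_indicator) (use finite_atom in auto)
  then have "integrable M (\<lambda>t. (cmod (pt z t))\<^sup>2)"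
    by (rule Bochner_Integration.integrable_cong[THEN iffD1, rotated -1]) (auto simp: pt_def indicator_def)
  then show ?thesis by (simp add: L2_def)
qed

lemma domQ_pt: "domQ M (pt z)"
proof -
  have "(\<lambda>t. complex_of_real t * pt z t) = (\<lambda>t. z * pt z t)" by (auto simp: pt_def)
  then show ?thesis using L2_pt[of z] L2_scale[OF L2_pt, of z z] by (simp add: domQ_def)
qed

lemma integral_pt: "(\<integral>t. pt z t \<partial>M) = complex_of_real (atom M z)"
proof -
  have "(\<integral>t. pt z t \<partial>M) = (\<integral>t. complex_of_real (indicator {t. complex_of_real t = z} t) \<partial>M)"
    by (rule Bochner_Integration.integral_cong) (auto simp: pt_def indicator_def)
  also have "\<dots> = complex_of_real (atom M z)"
    by (subst integral_complex_of_real) (auto simp: atom_def)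
  finally show ?thesis .
qed

lemma L2_rk_bounded:
  assumes "d > 0" "\<And>t. d \<le> cmod (complex_of_real t - z)"
  shows "L2 M (\<lambda>t. rk z t ^ Suc j)"
proof -
  obtain C where C: "C \<ge> 0" "\<And>t. cmod (rk z t) ^ (2 * Suc j) \<le> C / (1 + t\<^sup>2)"
    using rk_power_bound[OF assms(1)] assms(2) by blast
  have "integrable M (\<lambda>t. (cmod (rk z t ^ Suc j))\<^sup>2)"
  proof (rule Bochner_Integration.integrable_bound)
    show "integrable M (\<lambda>t. C * (1 / (1 + t\<^sup>2)))"
      by (rule integrable_mult_right[OF integrable_weight])
    show "AE t in M. norm ((cmod (rk z t ^ Suc j))\<^sup>2) \<le> norm (C * (1 / (1 + t\<^sup>2)))"
      using C by (auto simp: norm_power power_mult[symmetric] mult.commute add_pos_nonneg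
          simp del: power_Suc mult_Suc mult_Suc_right intro!: order_trans[OF _ abs_ge_self])
  qed measurable
  then show ?thesis by (auto simp: L2_def)
qed

text \<open>Where |t - z| \<ge> 1 every power is dominated by the weight. Where |t - z| < 1 the
  kernel has modulus at least 1, so lower powers are smaller, except at t = z, where all of them are
  0.\<close>

lemma L2_rk_mono:
  assumes "L2 M (\<lambda>t. rk z t ^ Suc j)" "i \<le> j"
  shows "L2 M (\<lambda>t. rk z t ^ Suc i)"
proof -
  obtain C where C: "C \<ge> 0" "\<And>t. 1 \<le> cmod (complex_of_real t - z) \<Longrightarrow> cmod (rk z t) ^ (2 * Suc i) \<le> C / (1 + t\<^sup>2)"
    using rk_power_bound[of 1 z i] by auto
  have "integrable M (\<lambda>t. (cmod (rk z t ^ Suc i))\<^sup>2)"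
  proof (rule Bochner_Integration.integrable_bound)
    show "integrable M (\<lambda>t. (cmod (rk z t ^ Suc j))\<^sup>2 + C * (1 / (1 + t\<^sup>2)))"
      using assms(1) by (intro Bochner_Integration.integrable_add integrable_mult_right integrable_weight)
        (simp add: L2_def)
    have "(cmod (rk z t ^ Suc i))\<^sup>2 \<le> (cmod (rk z t ^ Suc j))\<^sup>2 + C * (1 / (1 + t\<^sup>2))" for t
    proof (cases "1 \<le> cmod (complex_of_real t - z)")
      case True
      then show ?thesis using C(2)[OF True]
        by (auto simp: norm_power power_mult[symmetric] mult.commute
          simp del: power_Suc mult_Suc mult_Suc_right intro: order_trans)
    next
      case False
      have nn: "C * (1 / (1 + t\<^sup>2)) \<ge> 0" using C(1) by (simp add: add_nonneg_nonneg)
      have "(cmod (rk z t ^ Suc i))\<^sup>2 \<le> (cmod (rk z t ^ Suc j))\<^sup>2"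
      proof (cases "complex_of_real t = z")
        case True then show ?thesis by (simp add: rk_def)
      next
        case nz: False
        then have "1 \<le> cmod (rk z t)" using False
          by (simp add: rk_def norm_inverse one_le_inverse_iff)
        then have "cmod (rk z t) ^ Suc i \<le> cmod (rk z t) ^ Suc j"
          using assms(2) by (intro power_increasing) auto
        then show ?thesis unfolding norm_power by (intro power_mono) auto
      qed
      then show ?thesis using nn by linarith
    qed
    then show "AE t in M. norm ((cmod (rk z t ^ Suc i))\<^sup>2)
        \<le> norm ((cmod (rk z t ^ Suc j))\<^sup>2 + C * (1 / (1 + t\<^sup>2)))"
      by (auto intro: order_trans[OF _ abs_ge_self])
  qed measurable
  then show ?thesis by (auto simp: L2_def)
qed

lemma domQ_rk_power:
  assumes "L2 M (\<lambda>t. rk z t ^ Suc (Suc i))"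
  shows "domQ M (\<lambda>t. rk z t ^ Suc (Suc i))"
proof -
  have "complex_of_real t * rk z t ^ Suc (Suc i) = rk z t ^ Suc i + z * rk z t ^ Suc (Suc i)" for t
    using mult_rk_power[of t z i] by (simp only: left_diff_distrib) (simp add: algebra_simps)
  moreover have "L2 M (\<lambda>t. rk z t ^ Suc i)" using L2_rk_mono[OF assms, of i] by simp
  ultimately show ?thesis unfolding domQ_def
    using assms L2_add[OF _ L2_scale[OF assms, of z]] by presburger
qed

text \<open>Multiplied by t, the kernel tends to 1 at infinity, and a constant need not be square
  integrable. Subtracting t / (1 + t^2) removes exactly this constant. The term \<open>pt\<close>
  corrects the convention \<open>rk z t = 0\<close> at t = z.\<close>

lemma domQ_rk:
  assumes "L2 M (rk z)"
  shows "domQ M (\<lambda>t. rk z t - complex_of_real (t / (1 + t\<^sup>2)))"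
proof -
  have "complex_of_real t * (rk z t - complex_of_real (t / (1 + t\<^sup>2)))
      = (z * rk z t + complex_of_real (1 / (1 + t\<^sup>2))) - pt z t" for t
  proof -
    have "1 + t\<^sup>2 \<noteq> 0" by (metis add_pos_nonneg less_numeral_extra(1,3) zero_le_power2)
    then have "t * (t / (1 + t\<^sup>2)) = 1 - 1 / (1 + t\<^sup>2)" by (simp add: field_simps power2_eq_square)
    then have "complex_of_real t * complex_of_real (t / (1 + t\<^sup>2)) = 1 - complex_of_real (1 / (1 + t\<^sup>2))"
      by (metis of_real_mult of_real_diff of_real_1)
    moreover have "complex_of_real t * rk z t = z * rk z t + 1 - pt z t"
      using mult_rk[of t z] by (simp add: algebra_simps)
    ultimately show ?thesis by (simp only: right_diff_distrib) simp
  qed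
  then show ?thesis unfolding domQ_def
    using L2_diff[OF assms L2_weight_t] L2_diff[OF L2_add[OF L2_scale[OF assms, of z] L2_weight] L2_pt[of z]]
    by presburger
qed

end

section \<open>One half of the coupling\<close>

text \<open>Multiplication by t - z lowers each power by one and turns the first into the constant
  that is subtracted. At t = z all kernels are 0, so only \<open>- b 0\<close> survives; this is the
  origin of the new point mass, and the old mass s is lost.\<close>

lemma pol_step:
  "(complex_of_real t - z) * pol z s b (Suc n) t - b 0 = pol z (- b 0) (\<lambda>i. b (Suc i)) n t"
proof -
  have "(complex_of_real t - z) * pol z s b (Suc n) t
      = s * ((complex_of_real t - z) * pt z t) + (\<Sum>i<Suc n. b i * ((complex_of_real t - z) * rk z t ^ Suc i))"
    unfolding pol_def by (simp only: distrib_left sum_distrib_left mult.left_commute)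
  also have "(\<Sum>i<Suc n. b i * ((complex_of_real t - z) * rk z t ^ Suc i))
      = b 0 * (1 - pt z t) + (\<Sum>i<n. b (Suc i) * rk z t ^ Suc i)"
    by (subst sum.lessThan_Suc_shift) (simp only: mult_rk_power power_Suc0_right One_nat_def mult_rk)
  finally have "(complex_of_real t - z) * pol z s b (Suc n) t
      = b 0 * (1 - pt z t) + (\<Sum>i<n. b (Suc i) * rk z t ^ Suc i)" by (simp only: pt_mult) simp
  then show ?thesis unfolding pol_def[of z "- b 0"] by (simp only: right_diff_distrib) simp
qed

lemma pol_zero_coeff: "b n = 0 \<Longrightarrow> pol z s b (Suc n) = pol z s b n"
  by (auto simp: pol_def)

lemma Tstar_shift:
  assumes "f = q + c * complex_of_real (t / (t\<^sup>2 + 1))"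
  shows "complex_of_real t * q - c * complex_of_real (1 / (t\<^sup>2 + 1)) - z * f = (complex_of_real t - z) * f - c"
proof -
  have "t\<^sup>2 + 1 \<noteq> 0" by (metis add_nonneg_pos less_numeral_extra(1,3) zero_le_power2)
  then have "t * (t / (t\<^sup>2 + 1)) + 1 / (t\<^sup>2 + 1) = 1" by (simp add: field_simps power2_eq_square)
  then have "complex_of_real t * complex_of_real (t / (t\<^sup>2 + 1)) + complex_of_real (1 / (t\<^sup>2 + 1)) = 1"
    by (metis of_real_mult of_real_add of_real_1)
  then have "c * (complex_of_real t * complex_of_real (t / (t\<^sup>2 + 1)) + complex_of_real (1 / (t\<^sup>2 + 1))) = c"
    by simp
  then show ?thesis unfolding assms by (simp add: algebra_simps del: of_real_divide of_real_add)
qed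

section \<open>Combinations of kernels in the domain of the adjoint\<close>

context weighted_measure
begin

text \<open>Only the first power has to be compensated; the higher ones lie in the domain of Q by
  themselves. Integrability is asked for nonzero coefficients only, so that a combination may be
  given a greater formal length than the available moments permit.\<close>

lemma pol_domQ_Gamma1:
  fixes s :: complex
  assumes "\<And>i. i \<le> n \<Longrightarrow> b i \<noteq> 0 \<Longrightarrow> L2 M (\<lambda>t. rk z t ^ Suc i)"
  defines "q \<equiv> (\<lambda>t. pol z s b (Suc n) t - b 0 * complex_of_real (t / (t\<^sup>2 + 1)))"
  shows "domQ M q"
    and "Gamma1 M C (b 0) q = s * complex_of_real (atom M z) + (\<Sum>i<Suc n. b i * mom M C z i)"
proof -
  define w where "w = (\<lambda>t. rk z t - complex_of_real (t / (1 + t\<^sup>2)))"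
  have q: "q = (\<lambda>t. (s * pt z t + b 0 * w t) + (\<Sum>i<n. b (Suc i) * rk z t ^ Suc (Suc i)))"
    unfolding q_def pol_def w_def
    by (subst sum.lessThan_Suc_shift) (simp add: algebra_simps del: of_real_divide of_real_add)
  have d0: "domQ M (\<lambda>t. b 0 * w t)"
    using assms(1)[of 0] domQ_rk[of z] domQ_scale domQ_zero unfolding w_def
    by (cases "b 0 = 0") auto
  have di: "domQ M (\<lambda>t. b (Suc i) * rk z t ^ Suc (Suc i))" if "i < n" for i
    using assms(1)[of "Suc i"] domQ_rk_power[of z i] domQ_scale that domQ_zero
    by (cases "b (Suc i) = 0") auto
  have dsum: "domQ M (\<lambda>t. \<Sum>i<n. b (Suc i) * rk z t ^ Suc (Suc i))"
    by (rule domQ_sum) (use di in auto)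
  have dp: "domQ M (\<lambda>t. s * pt z t)" by (rule domQ_scale[OF domQ_pt])
  show "domQ M q" unfolding q by (intro domQ_add dp d0 dsum)
  note ints = domQ_imp_integrable[OF dp] domQ_imp_integrable[OF d0] domQ_imp_integrable[OF dsum]
  have "(\<integral>t. q t \<partial>M) = ((\<integral>t. s * pt z t \<partial>M) + (\<integral>t. b 0 * w t \<partial>M))
      + (\<integral>t. (\<Sum>i<n. b (Suc i) * rk z t ^ Suc (Suc i)) \<partial>M)"
    unfolding q using ints by (simp only: Bochner_Integration.integral_add Bochner_Integration.integrable_add)
  also have "(\<integral>t. (\<Sum>i<n. b (Suc i) * rk z t ^ Suc (Suc i)) \<partial>M)
      = (\<Sum>i<n. (\<integral>t. b (Suc i) * rk z t ^ Suc (Suc i) \<partial>M))"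
    by (rule Bochner_Integration.integral_sum) (use di domQ_imp_integrable in auto)
  also have "\<dots> = (\<Sum>i<n. b (Suc i) * mom M C z (Suc i))"
    unfolding mom_def by (simp del: power_Suc)
  finally have "(\<integral>t. q t \<partial>M) = s * complex_of_real (atom M z) + b 0 * (\<integral>t. w t \<partial>M)
      + (\<Sum>i<n. b (Suc i) * mom M C z (Suc i))"
    by (simp add: integral_pt)
  moreover have "(\<Sum>i<Suc n. b i * mom M C z i)
      = b 0 * (complex_of_real C + (\<integral>t. w t \<partial>M)) + (\<Sum>i<n. b (Suc i) * mom M C z (Suc i))"
    by (subst sum.lessThan_Suc_shift) (simp add: mom_def w_def)
  ultimately show "Gamma1 M C (b 0) q = s * complex_of_real (atom M z) + (\<Sum>i<Suc n. b i * mom M C z i)"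
    by (simp add: Gamma1_def algebra_simps)
qed

lemma Tdecomp_pol:
  assumes "\<And>i. i \<le> n \<Longrightarrow> b i \<noteq> 0 \<Longrightarrow> L2 M (\<lambda>t. rk z t ^ Suc i)"
  obtains q where "Tdecomp M (pol z s b (Suc n)) (b 0) q"
    "Gamma1 M C (b 0) q = s * complex_of_real (atom M z) + (\<Sum>i<Suc n. b i * mom M C z i)"
    "\<And>t. complex_of_real t * q t - b 0 * complex_of_real (1 / (t\<^sup>2 + 1)) - z * pol z s b (Suc n) t
        = pol z (- b 0) (\<lambda>i. b (Suc i)) n t"
proof -
  define q where "q = (\<lambda>t. pol z s b (Suc n) t - b 0 * complex_of_real (t / (t\<^sup>2 + 1)))"
  show ?thesis
  proof
    show "Tdecomp M (pol z s b (Suc n)) (b 0) q"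
      using pol_domQ_Gamma1(1)[of n b z s] assms by (simp add: Tdecomp_def q_def)
    show "Gamma1 M C (b 0) q = s * complex_of_real (atom M z) + (\<Sum>i<Suc n. b i * mom M C z i)"
      unfolding q_def by (rule pol_domQ_Gamma1(2)) (use assms in auto)
    fix t
    show "complex_of_real t * q t - b 0 * complex_of_real (1 / (t\<^sup>2 + 1)) - z * pol z s b (Suc n) t
        = pol z (- b 0) (\<lambda>i. b (Suc i)) n t"
      by (subst pol_step[symmetric], rule Tstar_shift) (simp add: q_def)
  qed
qed

text \<open>The converse of \<open>pol_step\<close>: off z the equation is divided by t - z, which
  puts c in front of the coefficients. At z the equation says nothing about f, whose value there
  becomes the new mass, but it says 0 = c + s, and this counts if z is an atom. If z is not an atom,
  the value \<open>f (Re z)\<close> has no influence modulo null functions.\<close>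

lemma Tdecomp_resolve:
  assumes T: "Tdecomp M f c q"
    and eq: "AE t in M. complex_of_real t * q t - c * complex_of_real (1 / (t\<^sup>2 + 1)) - z * f t = pol z s a n t"
  shows "AE t in M. f t = pol z (f (Re z)) (case_nat c a) (Suc n) t"
    and "atom M z \<noteq> 0 \<Longrightarrow> s = - c"
proof -
  have eq': "AE t in M. (complex_of_real t - z) * f t = c + pol z s a n t"
    using conjunct2[OF T[unfolded Tdecomp_def]] eq
  proof eventually_elim
    case (elim t)
    then show ?case using Tstar_shift[OF elim(1), of z] by (simp add: algebra_simps)
  qed
  then show "AE t in M. f t = pol z (f (Re z)) (case_nat c a) (Suc n) t"
  proof eventually_elim
    case (elim t)
    show ?case
    proof (cases "complex_of_real t = z")
      case True
      then have "Re z = t" by auto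
      then show ?thesis using True by (simp add: pol_def pt_def rk_def)
    next
      case False
      have sm: "(\<Sum>i<Suc n. case_nat c a i * rk z t ^ Suc i) = rk z t * (c + (\<Sum>i<n. a i * rk z t ^ Suc i))"
        by (subst sum.lessThan_Suc_shift) (simp add: algebra_simps sum_distrib_left)
      have "pol z (f (Re z)) (case_nat c a) (Suc n) t = rk z t * (c + pol z s a n t)"
        unfolding pol_def sm using False by (simp add: pt_def)
      also have "\<dots> = (rk z t * (complex_of_real t - z)) * f t"
        by (subst elim[symmetric]) simp
      also have "rk z t * (complex_of_real t - z) = 1"
        using False by (simp add: rk_def)
      finally show ?thesis by simp
    qed
  qed
  show "s = - c" if "atom M z \<noteq> 0"
    using AE_atomD[OF eq' that] by (auto simp: pol_def pt_def rk_def eq_neg_iff_add_eq_0 add.commute)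
qed

text \<open>Elements of the domain are square integrable, so subtracting the point mass and the
  lower powers isolates the top power.\<close>

lemma Tdecomp_pol_L2:
  assumes T: "Tdecomp M f c q"
    and f: "AE t in M. f t = pol z s b (Suc n) t"
    and low: "\<And>i. i < n \<Longrightarrow> b i \<noteq> 0 \<Longrightarrow> L2 M (\<lambda>t. rk z t ^ Suc i)" and "b n \<noteq> 0"
  shows "L2 M (\<lambda>t. rk z t ^ Suc n)"
proof -
  have q: "L2 M q" using T by (simp add: Tdecomp_def domQ_def)
  have wt: "L2 M (\<lambda>t. complex_of_real (t / (t\<^sup>2 + 1)))" using L2_weight_t by (simp add: add.commute)
  have "L2 M (pol z s b (Suc n))"
  proof (rule L2_cong_AE)
    show "L2 M (\<lambda>t. q t + c * complex_of_real (t / (t\<^sup>2 + 1)))"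
      by (intro L2_add q L2_scale wt)
    show "AE t in M. pol z s b (Suc n) t = q t + c * complex_of_real (t / (t\<^sup>2 + 1))"
      using f conjunct2[OF T[unfolded Tdecomp_def]] by eventually_elim simp
  qed measurable
  moreover have "L2 M (\<lambda>t. s * pt z t + (\<Sum>i<n. b i * rk z t ^ Suc i))"
  proof (rule L2_add[OF L2_scale[OF L2_pt] L2_sum])
    fix i assume "i \<in> {..<n}"
    then show "L2 M (\<lambda>t. b i * rk z t ^ Suc i)"
      using low[of i] L2_scale[of M _ "b i"] L2_zero by (cases "b i = 0") auto
  qed
  ultimately have "L2 M (\<lambda>t. (1 / b n) * (pol z s b (Suc n) t - (s * pt z t + (\<Sum>i<n. b i * rk z t ^ Suc i))))"
    by (intro L2_scale L2_diff)
  moreover have "(1 / b n) * (pol z s b (Suc n) t - (s * pt z t + (\<Sum>i<n. b i * rk z t ^ Suc i))) = rk z t ^ Suc n" for t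
    using \<open>b n \<noteq> 0\<close> by (simp add: pol_def)
  ultimately show ?thesis by simp
qed

lemma Tdecomp_pol_Gamma1:
  assumes T: "Tdecomp M f (b 0) q"
    and f: "AE t in M. f t = pol z s b (Suc n) t"
    and low: "\<And>i. i \<le> n \<Longrightarrow> b i \<noteq> 0 \<Longrightarrow> L2 M (\<lambda>t. rk z t ^ Suc i)"
  shows "Gamma1 M C (b 0) q = s * complex_of_real (atom M z) + (\<Sum>i<Suc n. b i * mom M C z i)"
proof -
  define p where "p = (\<lambda>t. pol z s b (Suc n) t - b 0 * complex_of_real (t / (t\<^sup>2 + 1)))"
  have p: "domQ M p" "Gamma1 M C (b 0) p = s * complex_of_real (atom M z) + (\<Sum>i<Suc n. b i * mom M C z i)"
    unfolding p_def using pol_domQ_Gamma1[of n b z] low by auto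
  have "(\<integral>t. q t \<partial>M) = (\<integral>t. p t \<partial>M)"
  proof (rule integral_cong_AE)
    show "q \<in> borel_measurable M" "p \<in> borel_measurable M"
      using T p(1) by (auto simp: Tdecomp_def domQ_def L2_def)
    show "AE t in M. q t = p t"
      using f conjunct2[OF T[unfolded Tdecomp_def]] unfolding p_def
      by eventually_elim (simp add: eq_diff_eq)
  qed
  then show ?thesis using p(2) by (simp add: Gamma1_def)
qed

text \<open>If some coefficient were nonzero, the measure would be concentrated on z and the
  preimage under \<open>rk z\<close> of the roots of a nonzero polynomial. As \<open>rk z\<close> is
  injective, this set is finite, and the weight gives every point finite mass, which contradicts the
  infinite total mass.\<close>

lemma pol_eq_0:
  assumes inf: "emeasure M UNIV = \<infinity>"
    and ae: "AE t in M. pol z s b n t = 0"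
  shows "i < n \<Longrightarrow> b i = 0" and "atom M z \<noteq> 0 \<Longrightarrow> s = 0"
proof -
  show "s = 0" if "atom M z \<noteq> 0"
    using AE_atomD[OF ae that] by (auto simp: pol_def pt_def rk_def)
  assume i: "i < n"
  show "b i = 0"
  proof (rule ccontr)
    assume "b i \<noteq> 0"
    \<comment> \<open>The coefficients are padded by a zero in degree n to match the form of
      \<open>polyfun_finite_roots\<close>.\<close>
    define F where "F = {w. (\<Sum>i\<le>n. (if i < n then b i else 0) * w ^ i) = 0}"
    have "finite F" unfolding F_def
      using polyfun_finite_roots[of "\<lambda>i. if i < n then b i else 0" n] i \<open>b i \<noteq> 0\<close> by auto
    moreover have "inj (rk z)" by (auto simp: inj_def rk_def)
    ultimately have fin: "finite (rk z -` F)" by (rule finite_vimageI)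
    define A where "A = {t. complex_of_real t = z} \<union> rk z -` F"
    have A: "AE t in M. t \<in> A"
      using ae
    proof eventually_elim
      case (elim t)
      show ?case
      proof (cases "complex_of_real t = z")
        case False
        have "pol z s b n t = rk z t * (\<Sum>i<n. b i * rk z t ^ i)"
          using False by (simp add: pol_def pt_def sum_distrib_left algebra_simps)
        then have "(\<Sum>i<n. b i * rk z t ^ i) = 0"
          using elim False by (simp add: rk_def)
        moreover have "(\<Sum>i\<le>n. (if i < n then b i else 0) * rk z t ^ i) = (\<Sum>i<n. b i * rk z t ^ i)"
          by (simp add: lessThan_Suc_atMost[symmetric])
        ultimately show ?thesis by (simp add: A_def F_def)
      qed (simp add: A_def)
    qed
    have "finite {t. complex_of_real t = z}"
      by (rule finite_subset[of _ "{Re z}"]) auto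
    then have finA: "finite A" using fin by (simp add: A_def)
    then have "emeasure M A < \<infinity>"
    proof (induction A rule: finite_induct)
      case (insert x A)
      have "emeasure M (insert x A) = emeasure M ({t. complex_of_real t = complex_of_real x} \<union> A)"
        by (rule arg_cong[where f="emeasure M"]) auto
      also have "\<dots> \<le> emeasure M {t. complex_of_real t = complex_of_real x} + emeasure M A"
        by (rule emeasure_subadditive) (use insert in \<open>auto intro: finite_imp_closed borel_closed\<close>)
      also have "\<dots> < \<infinity>" using insert finite_atom[of "complex_of_real x"] by simp
      finally show ?case .
    qed auto
    moreover have "emeasure M UNIV = emeasure M A"
      by (rule emeasure_eq_AE) (use A finA in \<open>auto intro: finite_imp_closed borel_closed\<close>)
    ultimately show False using inf by simp
  qed
qed

end

section \<open>Boundary values\<close>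

text \<open>Dominated convergence is applied along sequences, while the dominating bounds hold only
  near the limit point. Passing to a tail makes \<open>P\<close> hold for every index.\<close>

lemma tendsto_at_sequentiallyI:
  fixes f :: "'a::first_countable_topology \<Rightarrow> 'b::topological_space"
  assumes P: "eventually P (at a)"
    and seq: "\<And>X. (\<And>n. P (X n)) \<Longrightarrow> (\<And>n. X n \<noteq> a) \<Longrightarrow> X \<longlonglongrightarrow> a \<Longrightarrow> (\<lambda>n. f (X n)) \<longlonglongrightarrow> l"
  shows "(f \<longlongrightarrow> l) (at a)"
  unfolding tendsto_at_iff_sequentially
proof (intro allI impI)
  fix X assume X: "\<forall>i. X i \<in> UNIV - {a}" "X \<longlonglongrightarrow> a"
  then have "filterlim X (at a) sequentially" by (simp add: filterlim_at)
  then have "\<forall>\<^sub>F n in sequentially. P (X n)"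
    using P by (simp add: filterlim_iff)
  then obtain N where N: "\<And>n. N \<le> n \<Longrightarrow> P (X n)" by (auto simp: eventually_sequentially)
  have "(\<lambda>n. f (X (n + N))) \<longlonglongrightarrow> l"
    by (rule seq) (use N X in \<open>auto intro: LIMSEQ_ignore_initial_segment\<close>)
  then show "(f \<circ> X) \<longlonglongrightarrow> l" using LIMSEQ_offset[of "\<lambda>n. f (X n)" N l] by (simp add: comp_def)
qed

lemma rk_diff:
  assumes "complex_of_real t \<noteq> w" "complex_of_real t \<noteq> z"
  shows "rk w t - rk z t = (w - z) * (rk w t * rk z t)"
  using assms by (simp add: rk_def field_simps)

lemma rk_le:
  assumes "cmod (complex_of_real t - z) \<le> 2 * cmod (complex_of_real t - w)" "complex_of_real t \<noteq> z"
  shows "cmod (rk w t) \<le> 2 * cmod (rk z t)"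
proof -
  have "cmod (complex_of_real t - z) > 0" using assms(2) by simp
  moreover from this have "cmod (complex_of_real t - w) > 0" using assms(1) by linarith
  ultimately show ?thesis using assms(1) unfolding rk_def norm_inverse
    by (simp add: field_simps)
qed

lemma tendsto_rk:
  assumes "W \<longlonglongrightarrow> z" "complex_of_real t \<noteq> z"
  shows "(\<lambda>n. rk (W n) t) \<longlonglongrightarrow> rk z t"
  unfolding rk_def by (intro tendsto_intros assms) (use assms in auto)

section \<open>Limits and derivatives of the moments\<close>

context weighted_measure
begin

lemma L2_rk_nonreal:
  assumes "Im z \<noteq> 0"
  shows "L2 M (\<lambda>t. rk z t ^ Suc j)"
proof (rule L2_rk_bounded)
  show "\<bar>Im z\<bar> > 0" using assms by simp
  show "\<bar>Im z\<bar> \<le> cmod (complex_of_real t - z)" for t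
    using abs_Im_le_cmod[of "complex_of_real t - z"] by simp
qed

lemma integrable_rk_power:
  "L2 M (\<lambda>t. rk z t ^ Suc (Suc i)) \<Longrightarrow> integrable M (\<lambda>t. rk z t ^ Suc (Suc i))"
  by (rule domQ_imp_integrable[OF domQ_rk_power])

lemma integrable_rk:
  "L2 M (rk z) \<Longrightarrow> integrable M (\<lambda>t. rk z t - complex_of_real (t / (1 + t\<^sup>2)))"
  by (rule domQ_imp_integrable[OF domQ_rk])

lemma integrable_pt: "integrable M (\<lambda>t. a * pt z t)"
  by (rule domQ_imp_integrable[OF domQ_scale[OF domQ_pt]])

text \<open>Subtracting the contribution of the atom at \<open>z\<close> leaves a family dominated by powers of \<open>rk z\<close>.\<close>

lemma mom_boundary_seq:
  assumes W: "W \<longlonglongrightarrow> z" and nr: "\<And>n. Im (W n) \<noteq> 0"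
    and comp: "\<And>n t. cmod (complex_of_real t - z) \<le> 2 * cmod (complex_of_real t - W n)"
    and near: "\<And>n. cmod (W n - z) \<le> 1"
    and L: "L2 M (\<lambda>t. rk z t ^ Suc j)"
  shows "(\<lambda>n. mom M C (W n) j - inverse (z - W n) ^ Suc j * atom M z) \<longlonglongrightarrow> mom M C z j"
proof -
  have at: "rk (W n) t = inverse (z - W n)" "rk z t = 0" "pt z t = 1" if "complex_of_real t = z" for n t
    using that by (auto simp: rk_def pt_def)
  have off: "rk (W n) t - rk z t = (W n - z) * (rk (W n) t * rk z t)" if "complex_of_real t \<noteq> z" for n t
    using that by (intro rk_diff) (metis nr Im_complex_of_real)
  show ?thesis
  proof (cases j)
    case 0
    define F where "F = (\<lambda>n t. (rk (W n) t - complex_of_real (t / (1 + t\<^sup>2))) - inverse (z - W n) * pt z t)"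
    define f where "f = (\<lambda>t. rk z t - complex_of_real (t / (1 + t\<^sup>2)))"
    have L0: "L2 M (rk z)" using L 0 by simp
    have LW: "L2 M (rk (W n))" for n using L2_rk_nonreal[OF nr[of n], of 0] by simp
    have "(\<lambda>n. \<integral>t. F n t \<partial>M) \<longlonglongrightarrow> (\<integral>t. f t \<partial>M)"
    proof (rule integral_dominated_convergence)
      \<comment> \<open>The kernel itself need not be integrable, so twice its modulus is no
        admissible bound. The resolvent identity writes F n off z as f plus (W n - z) times a
        product of two kernels, and |W n - z| \<le> 1.\<close>
      show "integrable M (\<lambda>t. cmod (f t) + 2 * (cmod (rk z t))\<^sup>2)"
        using integrable_rk[OF L0] L0 by (auto simp: f_def L2_def)
      show "AE t in M. (\<lambda>n. F n t) \<longlonglongrightarrow> f t"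
      proof (rule AE_I2)
        fix t
        show "(\<lambda>n. F n t) \<longlonglongrightarrow> f t"
        proof (cases "complex_of_real t = z")
          case True
          then show ?thesis by (simp add: F_def f_def at)
        next
          case False
          then show ?thesis unfolding F_def f_def
            by (auto simp: pt_def intro!: tendsto_intros tendsto_rk W)
        qed
      qed
      show "AE t in M. norm (F n t) \<le> cmod (f t) + 2 * (cmod (rk z t))\<^sup>2" for n
      proof (rule AE_I2)
        fix t
        show "norm (F n t) \<le> cmod (f t) + 2 * (cmod (rk z t))\<^sup>2"
        proof (cases "complex_of_real t = z")
          case True
          then show ?thesis by (simp add: F_def f_def at)
        next
          case False
          have "F n t = f t + (W n - z) * (rk (W n) t * rk z t)"
            unfolding off[OF False, symmetric] using False by (simp add: F_def f_def pt_def)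
          then have "cmod (F n t) \<le> cmod (f t) + cmod (W n - z) * (cmod (rk (W n) t) * cmod (rk z t))"
            by (metis norm_mult norm_triangle_ineq)
          also have "cmod (W n - z) * (cmod (rk (W n) t) * cmod (rk z t)) \<le> 1 * ((2 * cmod (rk z t)) * cmod (rk z t))"
            using near[of n] rk_le[OF comp False, of n] by (intro mult_mono) auto
          finally show ?thesis by (simp add: power2_eq_square)
        qed
      qed
    qed (simp_all add: F_def f_def)
    moreover have "(\<integral>t. F n t \<partial>M) = (\<integral>t. rk (W n) t - complex_of_real (t / (1 + t\<^sup>2)) \<partial>M)
        - inverse (z - W n) * atom M z" for n
      unfolding F_def
      by (subst Bochner_Integration.integral_diff[OF integrable_rk[OF LW] integrable_pt]) (simp add: integral_pt)
    ultimately have "(\<lambda>n. (\<integral>t. rk (W n) t - complex_of_real (t / (1 + t\<^sup>2)) \<partial>M)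
        - inverse (z - W n) * atom M z) \<longlonglongrightarrow> (\<integral>t. f t \<partial>M)" by simp
    from tendsto_add[OF tendsto_const[of "complex_of_real C"] this]
    show ?thesis using 0 by (simp add: mom_def f_def algebra_simps)
  next
    case (Suc i)
    define F where "F = (\<lambda>n t. rk (W n) t ^ Suc j - inverse (z - W n) ^ Suc j * pt z t)"
    have LW: "L2 M (\<lambda>t. rk (W n) t ^ Suc j)" for n using L2_rk_nonreal[OF nr[of n]] .
    have "(\<lambda>n. \<integral>t. F n t \<partial>M) \<longlonglongrightarrow> (\<integral>t. rk z t ^ Suc j \<partial>M)"
    proof (rule integral_dominated_convergence)
      \<comment> \<open>From j = 1 on the power is integrable without compensation, and comparing
        the kernels costs a factor 2 for each power.\<close>
      show "integrable M (\<lambda>t. 2 ^ Suc j * cmod (rk z t ^ Suc j))"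
        using integrable_norm[OF integrable_rk_power[of z i]] L unfolding Suc by simp
      show "AE t in M. (\<lambda>n. F n t) \<longlonglongrightarrow> rk z t ^ Suc j"
      proof (rule AE_I2)
        fix t
        show "(\<lambda>n. F n t) \<longlonglongrightarrow> rk z t ^ Suc j"
        proof (cases "complex_of_real t = z")
          case True
          then show ?thesis by (simp add: F_def at)
        next
          case False
          then show ?thesis unfolding F_def
            by (auto simp: pt_def simp del: power_Suc intro!: tendsto_power tendsto_rk W)
        qed
      qed
      show "AE t in M. norm (F n t) \<le> 2 ^ Suc j * cmod (rk z t ^ Suc j)" for n
      proof (rule AE_I2)
        fix t
        show "norm (F n t) \<le> 2 ^ Suc j * cmod (rk z t ^ Suc j)"
        proof (cases "complex_of_real t = z")
          case True
          then show ?thesis by (simp add: F_def at)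
        next
          case False
          have "cmod (rk (W n) t) ^ Suc j \<le> (2 * cmod (rk z t)) ^ Suc j"
            by (intro power_mono rk_le[OF comp False]) auto
          then show ?thesis using False
            by (simp add: F_def pt_def norm_power power_mult_distrib del: power_Suc)
        qed
      qed
    qed (simp_all add: F_def)
    moreover have "(\<integral>t. F n t \<partial>M) = (\<integral>t. rk (W n) t ^ Suc j \<partial>M) - inverse (z - W n) ^ Suc j * atom M z" for n
      unfolding F_def
      by (subst Bochner_Integration.integral_diff[OF _ integrable_pt])
        (use integrable_rk_power[OF LW[unfolded Suc], folded Suc] in \<open>auto simp: integral_pt simp del: power_Suc\<close>)
    ultimately show ?thesis using Suc by (simp add: mom_def del: power_Suc)
  qed
qed

text \<open>From a real z, a vertical displacement only increases the distance to a real t. From a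
  nonreal z, a displacement below |Im z| / 2 at most halves that distance and does not reach the
  real axis.\<close>

lemma eventually_near_axis:
  "\<forall>\<^sub>F e in at (0::real). Im (z + \<i> * complex_of_real e) \<noteq> 0 \<and>
     (\<forall>t. cmod (complex_of_real t - z) \<le> 2 * cmod (complex_of_real t - (z + \<i> * complex_of_real e))) \<and>
     cmod (z + \<i> * complex_of_real e - z) \<le> 1"
proof -
  define r where "r = (if Im z = 0 then 1 else min 1 (\<bar>Im z\<bar> / 2))"
  have r: "r > 0" by (simp add: r_def)
  then have "\<forall>\<^sub>F e in at (0::real). e \<noteq> 0 \<and> \<bar>e\<bar> < r"
    unfolding eventually_at by (intro exI[of _ r]) (auto simp: dist_real_def)
  then show ?thesis
  proof eventually_elim
    case (elim e)
    then have e: "e \<noteq> 0" "\<bar>e\<bar> < r" by auto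
    have n: "cmod (z + \<i> * complex_of_real e - z) = \<bar>e\<bar>" by (simp add: norm_mult)
    have 1: "\<bar>e\<bar> \<le> 1" using e(2) by (auto simp: r_def split: if_splits)
    have 2: "cmod (complex_of_real t - z) \<le> 2 * cmod (complex_of_real t - (z + \<i> * complex_of_real e))" for t
    proof (cases "Im z = 0")
      case True
      then have "cmod (complex_of_real t - z) = \<bar>Re (complex_of_real t - (z + \<i> * complex_of_real e))\<bar>"
        by (simp add: cmod_def)
      also have "\<dots> \<le> cmod (complex_of_real t - (z + \<i> * complex_of_real e))" by (rule abs_Re_le_cmod)
      finally show ?thesis by (smt (verit) norm_ge_zero)
    next
      case False
      have "\<bar>e\<bar> \<le> \<bar>Im z\<bar> / 2" using e(2) False by (auto simp: r_def)
      also have "\<bar>Im z\<bar> \<le> cmod (complex_of_real t - z)"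
        using abs_Im_le_cmod[of "complex_of_real t - z"] by simp
      finally have "\<bar>e\<bar> \<le> cmod (complex_of_real t - z) / 2" by simp
      moreover have "cmod (complex_of_real t - z)
          \<le> cmod (complex_of_real t - (z + \<i> * complex_of_real e)) + \<bar>e\<bar>"
        using norm_triangle_ineq[of "complex_of_real t - (z + \<i> * complex_of_real e)" "z + \<i> * complex_of_real e - z"]
        unfolding n by simp
      ultimately show ?thesis by linarith
    qed
    have 3: "Im (z + \<i> * complex_of_real e) \<noteq> 0"
      using e by (auto simp: r_def split: if_splits)
    show ?case unfolding n using 1 2 3 by auto
  qed
qed

text \<open>The subtracted power is the value of \<open>rk (z + \<i> * e) t ^ Suc j\<close> at t =
  z, hence the share of the atom in the moment, which may blow up as e tends to 0.\<close>

lemma mom_boundary: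
  assumes "L2 M (\<lambda>t. rk z t ^ Suc j)"
  shows "((\<lambda>e::real. mom M C (z + \<i> * complex_of_real e) j
      - inverse (- (\<i> * complex_of_real e)) ^ Suc j * atom M z) \<longlongrightarrow> mom M C z j) (at 0)"
proof (rule tendsto_at_sequentiallyI[OF eventually_near_axis[of z]])
  fix X :: "nat \<Rightarrow> real"
  assume P: "\<And>n. Im (z + \<i> * complex_of_real (X n)) \<noteq> 0 \<and>
     (\<forall>t. cmod (complex_of_real t - z) \<le> 2 * cmod (complex_of_real t - (z + \<i> * complex_of_real (X n)))) \<and>
     cmod (z + \<i> * complex_of_real (X n) - z) \<le> 1"
    and X: "X \<longlonglongrightarrow> 0"
  have W: "(\<lambda>n. z + \<i> * complex_of_real (X n)) \<longlonglongrightarrow> z"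
    using tendsto_add[OF tendsto_const[of z] tendsto_mult[OF tendsto_const[of "\<i>"] tendsto_of_real[OF X]]] by simp
  have "(\<lambda>n. mom M C (z + \<i> * complex_of_real (X n)) j
      - inverse (z - (z + \<i> * complex_of_real (X n))) ^ Suc j * atom M z) \<longlonglongrightarrow> mom M C z j"
    by (rule mom_boundary_seq[OF W _ _ _ assms]) (use P in auto)
  then show "(\<lambda>n. mom M C (z + \<i> * complex_of_real (X n)) j
      - inverse (- (\<i> * complex_of_real (X n))) ^ Suc j * atom M z) \<longlonglongrightarrow> mom M C z j"
    by (simp only: minus_add_distrib diff_conv_add_uminus add.assoc[symmetric] right_minus add_0)
qed

lemma mom_has_derivative:
  assumes z: "Im z \<noteq> 0"
  shows "((\<lambda>w. mom M C w j) has_field_derivative of_nat (Suc j) * mom M C z (Suc j)) (at z)"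
  unfolding has_field_derivative_iff
proof (rule tendsto_at_sequentiallyI)
  show "\<forall>\<^sub>F w in at z. dist w z < \<bar>Im z\<bar> / 2"
    unfolding eventually_at using z by (intro exI[of _ "\<bar>Im z\<bar> / 2"]) auto
  fix W assume W0: "\<And>n. dist (W n) z < \<bar>Im z\<bar> / 2" and Wz: "\<And>n. W n \<noteq> z" and W: "W \<longlonglongrightarrow> z"
  have nr: "Im (W n) \<noteq> 0" for n
    using W0[of n] abs_Im_le_cmod[of "W n - z"] z by (auto simp: dist_norm)
  have comp: "cmod (complex_of_real t - z) \<le> 2 * cmod (complex_of_real t - W n)" for n t
    using W0[of n] abs_Im_le_cmod[of "complex_of_real t - z"]
      norm_triangle_ineq[of "complex_of_real t - W n" "W n - z"]
    by (simp add: dist_norm)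
  have nz: "complex_of_real t \<noteq> z" "complex_of_real t \<noteq> W n" for t n
    by (metis z Im_complex_of_real) (metis nr Im_complex_of_real)
  \<comment> \<open>The difference quotient of the power \<open>Suc j\<close>, factored so that no
    division is left: one factor is the resolvent identity, the other the geometric sum. It
    therefore also makes sense at w = z.\<close>
  define Q where "Q = (\<lambda>w t. rk w t * rk z t * (\<Sum>i<Suc j. rk z t ^ (j - i) * rk w t ^ i))"
  have Q: "rk (W n) t ^ Suc j - rk z t ^ Suc j = (W n - z) * Q (W n) t" for n t
    unfolding power_diff_sumr2 rk_diff[OF nz(2) nz(1)] by (simp add: Q_def mult.assoc)
  have Qz: "Q z t = of_nat (Suc j) * rk z t ^ Suc (Suc j)" for t
  proof -
    have "(\<Sum>i<Suc j. rk z t ^ (j - i) * rk z t ^ i) = (\<Sum>i<Suc j. rk z t ^ j)"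
      by (intro sum.cong) (auto simp: power_add[symmetric])
    then show ?thesis by (simp add: Q_def)
  qed
  have "(\<lambda>n. \<integral>t. Q (W n) t \<partial>M) \<longlonglongrightarrow> (\<integral>t. Q z t \<partial>M)"
  proof (rule integral_dominated_convergence)
    \<comment> \<open>Each kernel at W n costs a factor 2 against the kernel at z: one such kernel
      stands outside the sum, and i of them in its i-th term.\<close>
    define K where "K = 2 * (\<Sum>i<Suc j. 2 ^ i :: real)"
    show "integrable M (\<lambda>t. K * cmod (rk z t ^ Suc (Suc j)))"
      using integrable_norm[OF integrable_rk_power[OF L2_rk_nonreal[OF z]]] by simp
    show "AE t in M. (\<lambda>n. Q (W n) t) \<longlonglongrightarrow> Q z t"
      unfolding Q_def by (intro AE_I2 tendsto_intros tendsto_rk W nz)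
    show "AE t in M. norm (Q (W n) t) \<le> K * cmod (rk z t ^ Suc (Suc j))" for n
    proof (rule AE_I2)
      fix t
      have le: "cmod (rk (W n) t) \<le> 2 * cmod (rk z t)" by (rule rk_le[OF comp nz(1)])
      have "cmod (\<Sum>i<Suc j. rk z t ^ (j - i) * rk (W n) t ^ i) \<le> (\<Sum>i<Suc j. 2 ^ i * cmod (rk z t) ^ j)"
      proof (rule sum_norm_le)
        fix i assume "i \<in> {..<Suc j}"
        have "cmod (rk z t ^ (j - i) * rk (W n) t ^ i) \<le> cmod (rk z t) ^ (j - i) * (2 * cmod (rk z t)) ^ i"
          unfolding norm_mult norm_power by (intro mult_left_mono power_mono le) auto
        also have "\<dots> = 2 ^ i * (cmod (rk z t) ^ (j - i) * cmod (rk z t) ^ i)"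
          by (simp add: power_mult_distrib)
        also have "cmod (rk z t) ^ (j - i) * cmod (rk z t) ^ i = cmod (rk z t) ^ j"
          using \<open>i \<in> _\<close> by (simp add: power_add[symmetric])
        finally show "cmod (rk z t ^ (j - i) * rk (W n) t ^ i) \<le> 2 ^ i * cmod (rk z t) ^ j" .
      qed
      then have "cmod (Q (W n) t) \<le> (2 * cmod (rk z t)) * cmod (rk z t) * (\<Sum>i<Suc j. 2 ^ i * cmod (rk z t) ^ j)"
        unfolding Q_def norm_mult by (intro mult_mono le) auto
      also have "\<dots> = K * cmod (rk z t ^ Suc (Suc j))"
        unfolding K_def sum_distrib_right[symmetric] by (simp add: norm_power norm_mult)
      finally show "norm (Q (W n) t) \<le> K * cmod (rk z t ^ Suc (Suc j))" .
    qed
  qed (simp_all add: Q_def)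
  moreover have "(\<integral>t. Q z t \<partial>M) = of_nat (Suc j) * mom M C z (Suc j)"
    unfolding Qz by (simp add: mom_def del: power_Suc of_nat_Suc)
  moreover have "(mom M C (W n) j - mom M C z j) / (W n - z) = (\<integral>t. Q (W n) t \<partial>M)" for n
  proof -
    have "mom M C (W n) j - mom M C z j = (\<integral>t. rk (W n) t ^ Suc j - rk z t ^ Suc j \<partial>M)"
    proof (cases j)
      case 0
      have L: "L2 M (rk (W n))" "L2 M (rk z)"
        using L2_rk_nonreal[of _ 0] nr z by auto
      show ?thesis unfolding 0 mom_def
        using Bochner_Integration.integral_diff[OF integrable_rk[OF L(1)] integrable_rk[OF L(2)]] by simp
    next
      case (Suc i)
      show ?thesis unfolding Suc mom_def
        using Bochner_Integration.integral_diff[OF integrable_rk_power[OF L2_rk_nonreal[OF nr]]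
            integrable_rk_power[OF L2_rk_nonreal[OF z]], of n i i] by (simp del: power_Suc)
    qed
    also have "\<dots> = (W n - z) * (\<integral>t. Q (W n) t \<partial>M)" unfolding Q by simp
    finally show ?thesis using Wz[of n] by simp
  qed
  ultimately show "(\<lambda>n. (mom M C (W n) j - mom M C z j) / (W n - z)) \<longlonglongrightarrow> of_nat (Suc j) * mom M C z (Suc j)"
    by simp
qed

end

section \<open>Dimension of spaces of vectors modulo null functions\<close>

definition span_vec :: "nat \<Rightarrow> (nat \<Rightarrow> complex) \<Rightarrow> (nat \<Rightarrow> hvec) \<Rightarrow> hvec" where
  "span_vec n u g = ((\<lambda>t. \<Sum>i<n. u i * fst (g i) t), (\<lambda>t. \<Sum>i<n. u i * snd (g i) t))"

lemma fold_Hadd: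
  "fold Hadd (map (\<lambda>i. Hscale (a i) (xs i)) [0..<n]) (\<lambda>_. 0, \<lambda>_. 0) = span_vec n a xs"
  by (induction n) (simp_all add: span_vec_def Hadd_def Hscale_def add.commute)

text \<open>Gaussian elimination: if some vector p has a nonzero last coordinate, multiples of it
  clear that coordinate from the others, enumerated by \<open>\<sigma>\<close>, and the induction
  hypothesis applies to the remaining n coordinates.\<close>

lemma nontrivial_relation:
  fixes v :: "nat \<Rightarrow> nat \<Rightarrow> complex"
  assumes "n < m"
  shows "\<exists>a. (\<exists>i<m. a i \<noteq> 0) \<and> (\<forall>k<n. (\<Sum>i<m. a i * v i k) = 0)"
  using assms
proof (induction n arbitrary: m v)
  case 0
  then show ?case by (intro exI[of _ "\<lambda>_. 1"]) auto
next
  case (Suc n)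
  obtain m' where m: "m = Suc m'" "n < m'" using Suc.prems by (cases m) auto
  show ?case
  proof (cases "\<exists>p<m. v p n \<noteq> 0")
    case False
    obtain a where a: "\<exists>i<m'. a i \<noteq> 0" "\<And>k. k < n \<Longrightarrow> (\<Sum>i<m'. a i * v i k) = 0"
      using Suc.IH[OF m(2), of v] by blast
    define b where "b = (\<lambda>i. if i < m' then a i else 0)"
    have "(\<Sum>i<m. b i * v i k) = 0" if "k < Suc n" for k
      using that False a(2)[of k] by (cases "k = n") (auto simp: b_def m)
    moreover have "\<exists>i<m. b i \<noteq> 0" using a(1) m by (auto simp: b_def)
    ultimately show ?thesis by blast
  next
    case True
    then obtain p where p: "p < m" "v p n \<noteq> 0" by blast
    define \<sigma> where "\<sigma> = (\<lambda>i. if i < p then i else Suc i)"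
    have bij: "bij_betw \<sigma> {..<m'} ({..<m} - {p})"
    proof (rule bij_betw_byWitness[where f' = "\<lambda>i. if i < p then i else i - 1"])
    qed (use p m in \<open>auto simp: \<sigma>_def\<close>)
    define w where "w = (\<lambda>i k. v (\<sigma> i) k - v (\<sigma> i) n / v p n * v p k)"
    obtain a where a: "\<exists>i<m'. a i \<noteq> 0" "\<And>k. k < n \<Longrightarrow> (\<Sum>i<m'. a i * w i k) = 0"
      using Suc.IH[OF m(2), of w] by blast
    \<comment> \<open>The coefficient at the pivot is the one that makes the sum of the last
      coordinates vanish; the others are carried over along \<open>\<sigma>\<close>.\<close>
    define b where "b = (\<lambda>i. if i = p then - (\<Sum>i<m'. a i * v (\<sigma> i) n) / v p n else a (inv_into {..<m'} \<sigma> i))"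
    have b: "b (\<sigma> i) = a i" if "i < m'" for i
      using that bij bij_betw_inv_into_left[OF bij] by (auto simp: b_def \<sigma>_def split: if_splits)
    have "(\<Sum>i<m. b i * v i k) = 0" if "k < Suc n" for k
    proof -
      have "(\<Sum>i<m. b i * v i k) = b p * v p k + (\<Sum>i\<in>{..<m} - {p}. b i * v i k)"
        using p by (simp add: sum.remove[of "{..<m}" p])
      also have "(\<Sum>i\<in>{..<m} - {p}. b i * v i k) = (\<Sum>i<m'. b (\<sigma> i) * v (\<sigma> i) k)"
        by (rule sum.reindex_bij_betw[OF bij, symmetric])
      also have "\<dots> = (\<Sum>i<m'. a i * v (\<sigma> i) k)" by (intro sum.cong) (auto simp: b)
      also have "b p * v p k + (\<Sum>i<m'. a i * v (\<sigma> i) k) = (\<Sum>i<m'. a i * w i k)"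
        by (simp add: b_def w_def algebra_simps sum_subtractf sum_distrib_left sum_divide_distrib)
      also have "\<dots> = 0"
        using that a(2)[of k] p(2) by (cases "k = n") (auto simp: w_def)
      finally show ?thesis .
    qed
    moreover obtain i where "i < m'" "a i \<noteq> 0" using a(1) by blast
    then have "\<sigma> i < m \<and> b (\<sigma> i) \<noteq> 0" using b m by (auto simp: \<sigma>_def)
    ultimately show ?thesis by blast
  qed
qed

lemma Hdim_ge:
  assumes P: "\<And>k. k < n \<Longrightarrow> P (g k)"
    and indep: "\<And>u k. Hzero Sp Sm (span_vec n u g) \<Longrightarrow> k < n \<Longrightarrow> u k = 0"
  shows "enat n \<le> Hdim Sp Sm P"
  unfolding Hdim_def
proof (rule Sup_upper, rule CollectI, intro exI conjI)
  let ?xs = "map g [0..<n]"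
  show "enat n = enat (length ?xs)" by simp
  show "\<forall>x\<in>set ?xs. P x" using P by auto
  have eq: "map (\<lambda>i. Hscale (a i) (?xs ! i)) [0..<n] = map (\<lambda>i. Hscale (a i) (g i)) [0..<n]" for a
    by (intro map_cong) auto
  show "Hlin_indep Sp Sm ?xs"
    unfolding Hlin_indep_def length_map length_upt diff_zero eq fold_Hadd using indep by blast
qed

text \<open>Coordinates with respect to g are taken modulo null functions and need not be unique. A
  relation between the coordinate vectors still passes to the vectors, since finitely many null sets
  can be discarded together.\<close>

lemma Hdim_le:
  assumes span: "\<And>x. P x \<Longrightarrow> \<exists>u. Hzero Sp Sm (Hdiff x (span_vec n u g))"
  shows "Hdim Sp Sm P \<le> enat n"
  unfolding Hdim_def
proof (rule Sup_least, clarify)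
  fix xs assume xs: "\<forall>x\<in>set xs. P x" and li: "Hlin_indep Sp Sm xs"
  show "enat (length xs) \<le> enat n"
  proof (rule ccontr)
    let ?m = "length xs"
    assume "\<not> enat ?m \<le> enat n"
    then have lt: "n < ?m" by simp
    have "\<forall>i. \<exists>u. i < ?m \<longrightarrow> Hzero Sp Sm (Hdiff (xs ! i) (span_vec n u g))"
      using span xs by auto
    then obtain u where u: "\<And>i. i < ?m \<Longrightarrow> Hzero Sp Sm (Hdiff (xs ! i) (span_vec n (u i) g))"
      by metis
    obtain a where a: "\<exists>i<?m. a i \<noteq> 0" "\<And>k. k < n \<Longrightarrow> (\<Sum>i<?m. a i * u i k) = 0"
      using nontrivial_relation[OF lt, of u] by blast
    have vanish: "(\<Sum>i<?m. a i * f i) = 0"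
      if "\<forall>i\<in>{..<?m}. f i = (\<Sum>k<n. u i k * h k)" for f h :: "nat \<Rightarrow> complex"
    proof -
      have "(\<Sum>i<?m. a i * f i) = (\<Sum>i<?m. \<Sum>k<n. a i * u i k * h k)"
        using that by (intro sum.cong) (auto simp: sum_distrib_left mult.assoc)
      also have "\<dots> = (\<Sum>k<n. (\<Sum>i<?m. a i * u i k) * h k)"
        by (subst sum.swap) (simp add: sum_distrib_right)
      also have "\<dots> = 0" using a(2) by simp
      finally show ?thesis .
    qed
    have "AE t in dS Sp. \<forall>i\<in>{..<?m}. fst (xs ! i) t = (\<Sum>k<n. u i k * fst (g k) t)"
      by (rule AE_finite_allI) (use u in \<open>auto simp: Hzero_def null_def Hdiff_def span_vec_def\<close>)
    then have 1: "AE t in dS Sp. (\<Sum>i<?m. a i * fst (xs ! i) t) = 0"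
      by eventually_elim (rule vanish)
    have "AE t in dS Sm. \<forall>i\<in>{..<?m}. snd (xs ! i) t = (\<Sum>k<n. u i k * snd (g k) t)"
      by (rule AE_finite_allI) (use u in \<open>auto simp: Hzero_def null_def Hdiff_def span_vec_def\<close>)
    then have 2: "AE t in dS Sm. (\<Sum>i<?m. a i * snd (xs ! i) t) = 0"
      by eventually_elim (rule vanish)
    have "Hzero Sp Sm (span_vec ?m a (\<lambda>i. xs ! i))"
      using 1 2 by (auto simp: Hzero_def null_def span_vec_def)
    then have "\<forall>i<?m. a i = 0"
      using li unfolding Hlin_indep_def fold_Hadd by blast
    then show False using a(1) by blast
  qed
qed

section \<open>The coupled operator\<close>

lemma diff_add_diff_eq_0_iff:
  fixes a b c d :: "'a::ab_group_add"
  shows "a - b + (c - d) = 0 \<longleftrightarrow> a + c = b + d"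
  by (simp add: add_diff_add[symmetric])

locale coupling =
  fixes Sp Sm :: "real \<Rightarrow> real" and Cp Cm :: real and lam :: complex
  assumes adm_p: "admissible Sp" and adm_m: "admissible Sm"
begin

sublocale p: weighted_measure "dS Sp"
  using adm_p by unfold_locales (auto simp: admissible_def dS_def)

sublocale m: weighted_measure "dS Sm"
  using adm_m by unfold_locales (auto simp: admissible_def dS_def)

abbreviation R where "R \<equiv> Ashift Sp Cp Sm Cm lam"
abbreviation vec :: "complex \<Rightarrow> complex \<Rightarrow> (nat \<Rightarrow> complex) \<Rightarrow> nat \<Rightarrow> hvec"
  where "vec sp sm b n \<equiv> (pol lam sp b n, pol lam sm b n)"
abbreviation aeq (infix "\<doteq>" 50) where "x \<doteq> y \<equiv> Hzero Sp Sm (Hdiff x y)"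
abbreviation Jp where "Jp \<equiv> complex_of_real (atom (dS Sp) lam)"
abbreviation Jm where "Jm \<equiv> complex_of_real (atom (dS Sm) lam)"

text \<open>The amount by which the coefficient j of a combination disturbs the equality of the two
  \<open>\<Gamma>\<^sub>1\<close>.\<close>

definition Psi :: "nat \<Rightarrow> complex" where
  "Psi j = mom (dS Sp) Cp lam j - mom (dS Sm) Cm lam j"

text \<open>Indexed by the coefficient that it admits: \<open>reg j\<close> concerns the moment of
  order 2 (j + 1), that is \<open>negmom'\<close> with index \<open>Suc j\<close>.\<close>

definition reg :: "nat \<Rightarrow> bool" where
  "reg j \<longleftrightarrow> L2 (dS Sp) (\<lambda>t. rk lam t ^ Suc j) \<and> L2 (dS Sm) (\<lambda>t. rk lam t ^ Suc j)"

lemma reg_mono: "reg j \<Longrightarrow> i \<le> j \<Longrightarrow> reg i"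
  unfolding reg_def using p.L2_rk_mono m.L2_rk_mono by blast

lemma aeq_iff: "x \<doteq> y \<longleftrightarrow> (AE t in dS Sp. fst x t = fst y t) \<and> (AE t in dS Sm. snd x t = snd y t)"
  by (simp add: Hzero_def null_def Hdiff_def)

lemma aeq_trans: "x \<doteq> y \<Longrightarrow> y \<doteq> w \<Longrightarrow> x \<doteq> w"
  unfolding aeq_iff by auto

lemma Hzero_aeq: "x \<doteq> y \<Longrightarrow> Hzero Sp Sm x \<longleftrightarrow> Hzero Sp Sm y"
  unfolding aeq_iff by (auto simp: Hzero_def null_def)

text \<open>The hypothesis \<open>Gamma\<close> is the equality of the two
  \<open>\<Gamma>\<^sub>1\<close>. Whatever the masses sp and sm are, the image carries the same
  mass on both sides, so an asymmetry is possible only in the first vector of a chain.\<close>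

lemma Ashift_vec:
  assumes reg: "\<And>i. i \<le> n \<Longrightarrow> b i \<noteq> 0 \<Longrightarrow> reg i"
    and Gamma: "sp * Jp - sm * Jm + (\<Sum>i<Suc n. b i * Psi i) = 0"
  shows "R (vec sp sm b (Suc n)) (vec (- b 0) (- b 0) (\<lambda>i. b (Suc i)) n)"
proof -
  obtain qp where qp: "Tdecomp (dS Sp) (pol lam sp b (Suc n)) (b 0) qp"
    "Gamma1 (dS Sp) Cp (b 0) qp = sp * Jp + (\<Sum>i<Suc n. b i * mom (dS Sp) Cp lam i)"
    "\<And>t. complex_of_real t * qp t - b 0 * complex_of_real (1 / (t\<^sup>2 + 1)) - lam * pol lam sp b (Suc n) t
        = pol lam (- b 0) (\<lambda>i. b (Suc i)) n t"
    by (rule p.Tdecomp_pol[of n b lam sp Cp]) (use reg in \<open>auto simp: reg_def\<close>)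
  obtain qm where qm: "Tdecomp (dS Sm) (pol lam sm b (Suc n)) (b 0) qm"
    "Gamma1 (dS Sm) Cm (b 0) qm = sm * Jm + (\<Sum>i<Suc n. b i * mom (dS Sm) Cm lam i)"
    "\<And>t. complex_of_real t * qm t - b 0 * complex_of_real (1 / (t\<^sup>2 + 1)) - lam * pol lam sm b (Suc n) t
        = pol lam (- b 0) (\<lambda>i. b (Suc i)) n t"
    by (rule m.Tdecomp_pol[of n b lam sm Cm]) (use reg in \<open>auto simp: reg_def\<close>)
  have G: "Gamma1 (dS Sp) Cp (b 0) qp = Gamma1 (dS Sm) Cm (b 0) qm"
  proof -
    have "(\<Sum>i<Suc n. b i * Psi i)
        = (\<Sum>i<Suc n. b i * mom (dS Sp) Cp lam i) - (\<Sum>i<Suc n. b i * mom (dS Sm) Cm lam i)"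
      unfolding Psi_def right_diff_distrib sum_subtractf ..
    then show ?thesis using Gamma unfolding qp(2) qm(2) by (simp only: diff_add_diff_eq_0_iff)
  qed
  define z where "z = ((\<lambda>t. complex_of_real t * qp t - b 0 * complex_of_real (1 / (t\<^sup>2 + 1))),
    (\<lambda>t. complex_of_real t * qm t - b 0 * complex_of_real (1 / (t\<^sup>2 + 1))))"
  have "Ahat Sp Cp Sm Cm (vec sp sm b (Suc n)) z"
    unfolding Ahat_def using qp(1) qm(1) G by (auto simp: z_def intro!: exI[of _ "b 0"])
  moreover have "vec (- b 0) (- b 0) (\<lambda>i. b (Suc i)) n \<doteq> Hdiff z (Hscale lam (vec sp sm b (Suc n)))"
    unfolding aeq_iff by (simp add: Hdiff_def Hscale_def z_def qp(3) qm(3) del: of_real_divide)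
  ultimately show ?thesis unfolding Ashift_def by blast
qed

text \<open>One scalar c serves both sides because \<open>\<Gamma>\<^sub>0\<close> is coupled. The
  last two conclusions are implications that are discharged in turn: moments of the lower powers
  yield the moment of the top power, and only with all of them can \<open>\<Gamma>\<^sub>1\<close>
  be expressed by moments.\<close>

lemma Ashift_resolve:
  assumes "R x y" "y \<doteq> vec sp sm a n"
  shows "\<exists>c sp' sm'. x \<doteq> vec sp' sm' (case_nat c a) (Suc n) \<and>
    (Jp \<noteq> 0 \<longrightarrow> sp = - c) \<and> (Jm \<noteq> 0 \<longrightarrow> sm = - c) \<and>
    ((\<forall>i<n. case_nat c a i \<noteq> 0 \<longrightarrow> reg i) \<longrightarrow> case_nat c a n \<noteq> 0 \<longrightarrow> reg n) \<and>
    ((\<forall>i\<le>n. case_nat c a i \<noteq> 0 \<longrightarrow> reg i) \<longrightarrow>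
       sp' * Jp - sm' * Jm + (\<Sum>i<Suc n. case_nat c a i * Psi i) = 0)"
proof -
  obtain z where z: "Ahat Sp Cp Sm Cm x z" "y \<doteq> Hdiff z (Hscale lam x)"
    using assms(1) unfolding Ashift_def by blast
  obtain c qp qm where T: "Tdecomp (dS Sp) (fst x) c qp" "Tdecomp (dS Sm) (snd x) c qm"
    and G: "Gamma1 (dS Sp) Cp c qp = Gamma1 (dS Sm) Cm c qm"
    and zp: "AE t in dS Sp. fst z t = complex_of_real t * qp t - c * complex_of_real (1 / (t\<^sup>2 + 1))"
    and zm: "AE t in dS Sm. snd z t = complex_of_real t * qm t - c * complex_of_real (1 / (t\<^sup>2 + 1))"
    using z(1) unfolding Ahat_def by blast
  have yp: "AE t in dS Sp. fst y t = fst z t - lam * fst x t" "AE t in dS Sp. fst y t = pol lam sp a n t"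
    and ym: "AE t in dS Sm. snd y t = snd z t - lam * snd x t" "AE t in dS Sm. snd y t = pol lam sm a n t"
    using z(2) assms(2) unfolding aeq_iff by (simp_all add: Hdiff_def Hscale_def)
  have ep: "AE t in dS Sp. complex_of_real t * qp t - c * complex_of_real (1 / (t\<^sup>2 + 1)) - lam * fst x t
      = pol lam sp a n t"
    using yp zp by eventually_elim (simp del: of_real_divide)
  have em: "AE t in dS Sm. complex_of_real t * qm t - c * complex_of_real (1 / (t\<^sup>2 + 1)) - lam * snd x t
      = pol lam sm a n t"
    using ym zm by eventually_elim (simp del: of_real_divide)
  define sp' sm' where "sp' = fst x (Re lam)" and "sm' = snd x (Re lam)"
  have xp: "AE t in dS Sp. fst x t = pol lam sp' (case_nat c a) (Suc n) t"
    unfolding sp'_def by (rule p.Tdecomp_resolve(1)[OF T(1) ep])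
  have xm: "AE t in dS Sm. snd x t = pol lam sm' (case_nat c a) (Suc n) t"
    unfolding sm'_def by (rule m.Tdecomp_resolve(1)[OF T(2) em])
  have 1: "x \<doteq> vec sp' sm' (case_nat c a) (Suc n)" using xp xm by (simp add: aeq_iff)
  have 2: "Jp \<noteq> 0 \<longrightarrow> sp = - c" using p.Tdecomp_resolve(2)[OF T(1) ep] by simp
  have 3: "Jm \<noteq> 0 \<longrightarrow> sm = - c" using m.Tdecomp_resolve(2)[OF T(2) em] by simp
  have 4: "reg n" if low: "\<forall>i<n. case_nat c a i \<noteq> 0 \<longrightarrow> reg i" and nz: "case_nat c a n \<noteq> 0"
  proof -
    have "L2 (dS Sp) (\<lambda>t. rk lam t ^ Suc n)"
      by (rule p.Tdecomp_pol_L2[OF T(1) xp _ nz]) (use low in \<open>simp add: reg_def\<close>)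
    moreover have "L2 (dS Sm) (\<lambda>t. rk lam t ^ Suc n)"
      by (rule m.Tdecomp_pol_L2[OF T(2) xm _ nz]) (use low in \<open>simp add: reg_def\<close>)
    ultimately show ?thesis by (simp add: reg_def)
  qed
  have 5: "sp' * Jp - sm' * Jm + (\<Sum>i<Suc n. case_nat c a i * Psi i) = 0"
    if low: "\<forall>i\<le>n. case_nat c a i \<noteq> 0 \<longrightarrow> reg i"
  proof -
    have "Gamma1 (dS Sp) Cp (case_nat c a 0) qp = sp' * Jp + (\<Sum>i<Suc n. case_nat c a i * mom (dS Sp) Cp lam i)"
      by (rule p.Tdecomp_pol_Gamma1[OF _ xp]) (use T low in \<open>simp_all add: reg_def\<close>)
    moreover have "Gamma1 (dS Sm) Cm (case_nat c a 0) qm = sm' * Jm + (\<Sum>i<Suc n. case_nat c a i * mom (dS Sm) Cm lam i)"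
      by (rule m.Tdecomp_pol_Gamma1[OF _ xm]) (use T low in \<open>simp_all add: reg_def\<close>)
    moreover have "(\<Sum>i<Suc n. case_nat c a i * Psi i)
        = (\<Sum>i<Suc n. case_nat c a i * mom (dS Sp) Cp lam i) - (\<Sum>i<Suc n. case_nat c a i * mom (dS Sm) Cm lam i)"
      unfolding Psi_def right_diff_distrib sum_subtractf ..
    ultimately show ?thesis using G by (simp only: diff_add_diff_eq_0_iff nat.case)
  qed
  show ?thesis using 1 2 3 4 5 by blast
qed

lemma Hvec_vec:
  assumes "\<And>i. i < n \<Longrightarrow> b i \<noteq> 0 \<Longrightarrow> reg i"
  shows "Hvec Sp Sm (vec sp sm b n)"
proof -
  have "L2 (dS Sp) (\<lambda>t. b i * rk lam t ^ Suc i) \<and> L2 (dS Sm) (\<lambda>t. b i * rk lam t ^ Suc i)" if "i < n" for i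
    using assms[OF that] L2_scale L2_zero unfolding reg_def by (cases "b i = 0") auto
  then have "L2 (dS Sp) (\<lambda>t. sp * pt lam t + (\<Sum>i<n. b i * rk lam t ^ Suc i))"
    "L2 (dS Sm) (\<lambda>t. sm * pt lam t + (\<Sum>i<n. b i * rk lam t ^ Suc i))"
    by (intro L2_add[OF L2_scale[OF p.L2_pt] L2_sum] L2_add[OF L2_scale[OF m.L2_pt] L2_sum]; simp)+
  then show ?thesis by (simp add: Hvec_def pol_def[abs_def])
qed

lemma Hzero_vec0: "Hzero Sp Sm (vec 0 0 b 0)"
  by (simp add: Hzero_def null_def pol_def)

lemma Hzero_imp_aeq: "Hzero Sp Sm x \<Longrightarrow> x \<doteq> vec 0 0 b 0"
  by (simp add: Hzero_def null_def pol_def Hdiff_def)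

lemma vec_zero_coeff: "b n = 0 \<Longrightarrow> vec sp sm b (Suc n) = vec sp sm b n"
  by (simp add: pol_zero_coeff)

text \<open>A chain is climbed from its null end, so a property passes to all root vectors once it
  is inherited by preimages. All upper bounds for the algebraic multiplicity rest on this.\<close>

lemma rootvec_induct:
  assumes "rootvec Sp Cp Sm Cm lam x"
    and base: "\<And>x. Hzero Sp Sm x \<Longrightarrow> Q x"
    and step: "\<And>x y. R x y \<Longrightarrow> Q y \<Longrightarrow> Q x"
  shows "Q x"
proof -
  obtain n y where "(R ^^ n) x y" "Hzero Sp Sm y" using assms(1) by (auto simp: rootvec_def)
  then show ?thesis
  proof (induction n arbitrary: x)
    case 0
    then show ?case using base by simp
  next
    case (Suc n)
    then show ?case using relpowp_Suc_D2[OF Suc.prems(1)] step by blast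
  qed
qed

lemma rootvec_step:
  assumes "Hvec Sp Sm x" "R x y" "(R ^^ n) y w" "Hzero Sp Sm w"
  shows "rootvec Sp Cp Sm Cm lam x"
  unfolding rootvec_def using assms relpowp_Suc_I2[of R x y n w] by blast

lemma eigvec_imp_rootvec: "eigvec Sp Cp Sm Cm lam x \<Longrightarrow> rootvec Sp Cp Sm Cm lam x"
  unfolding eigvec_def using rootvec_step[of x _ 0] by auto

text \<open>Equal masses on equal atoms cancel in the coupling, and each step reproduces equal
  masses. After n steps a pure point mass may be left, which takes one step more to annihilate;
  hence \<open>Suc n\<close>.\<close>

lemma chain_vec:
  assumes J: "Jp = Jm" and ok: "\<And>j. j < n \<Longrightarrow> reg j \<and> Psi j = 0"
  shows "\<exists>w. (R ^^ Suc n) (vec s s b n) w \<and> Hzero Sp Sm w"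
  using ok
proof (induction n arbitrary: s b)
  case 0
  \<comment> \<open>\<open>Ashift_vec\<close> needs positive length, so the point mass is written
    with one zero coefficient.\<close>
  have "R (vec s s (\<lambda>_. 0) (Suc 0)) (vec (- 0) (- 0) (\<lambda>_. 0) 0)"
    by (rule Ashift_vec) (use J in auto)
  then have "R (vec s s b 0) (vec 0 0 (\<lambda>_. 0) 0)" by (simp add: pol_def[abs_def])
  then have "(R ^^ Suc 0) (vec s s b 0) (vec 0 0 (\<lambda>_. 0) 0)" by (metis relpowp_1 One_nat_def)
  then show ?case using Hzero_vec0 by blast
next
  case (Suc n)
  have "R (vec s s b (Suc n)) (vec (- b 0) (- b 0) (\<lambda>i. b (Suc i)) n)"
    by (rule Ashift_vec) (use J Suc.prems in \<open>auto simp: less_Suc_eq_le\<close>)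
  moreover obtain w where "(R ^^ Suc n) (vec (- b 0) (- b 0) (\<lambda>i. b (Suc i)) n) w" "Hzero Sp Sm w"
    using Suc.IH[of "- b 0" "\<lambda>i. b (Suc i)"] Suc.prems by auto
  ultimately show ?case using relpowp_Suc_I2[of R] by blast
qed

lemma eigvec_vec0:
  assumes "sp * Jp = sm * Jm"
  shows "eigvec Sp Cp Sm Cm lam (vec sp sm b 0)"
proof -
  have "R (vec sp sm (\<lambda>_. 0) (Suc 0)) (vec (- 0) (- 0) (\<lambda>_. 0) 0)"
    by (rule Ashift_vec) (use assms in auto)
  then have "R (vec sp sm b 0) (vec 0 0 (\<lambda>_. 0) 0)" by (simp add: pol_def[abs_def])
  then show ?thesis unfolding eigvec_def using Hvec_vec[of 0 b sp sm] Hzero_vec0 by blast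
qed

text \<open>The image is null, hence a combination of length 0 with both masses 0. If lam is an atom
  on either side, the condition that the mass be - c then reads c = 0.\<close>

lemma eigvec_resolve:
  assumes "eigvec Sp Cp Sm Cm lam x"
  obtains c sp sm where "x \<doteq> vec sp sm (\<lambda>_. c) (Suc 0)" "Jp \<noteq> 0 \<or> Jm \<noteq> 0 \<Longrightarrow> c = 0"
    "c \<noteq> 0 \<Longrightarrow> reg 0" "sp * Jp - sm * Jm + c * Psi 0 = 0"
proof -
  obtain y where y: "R x y" "Hzero Sp Sm y" using assms by (auto simp: eigvec_def)
  obtain c sp sm where 1: "x \<doteq> vec sp sm (case_nat c (\<lambda>_. 0)) (Suc 0)"
    "Jp \<noteq> 0 \<longrightarrow> 0 = - c" "Jm \<noteq> 0 \<longrightarrow> 0 = - c"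
    and 2: "(\<forall>i<0. case_nat c (\<lambda>_. 0) i \<noteq> 0 \<longrightarrow> reg i) \<longrightarrow> case_nat c (\<lambda>_. 0) 0 \<noteq> 0 \<longrightarrow> reg 0"
    and 3: "(\<forall>i\<le>0. case_nat c (\<lambda>_. 0) i \<noteq> 0 \<longrightarrow> reg i) \<longrightarrow>
       sp * Jp - sm * Jm + (\<Sum>i<Suc 0. case_nat c (\<lambda>_. 0) i * Psi i) = 0"
    using Ashift_resolve[OF y(1) Hzero_imp_aeq[OF y(2), of "\<lambda>_. 0"]] by blast
  have r: "c \<noteq> 0 \<Longrightarrow> reg 0" using 2 by simp
  have "sp * Jp - sm * Jm + c * Psi 0 = 0" using 3 r by simp
  moreover have "x \<doteq> vec sp sm (\<lambda>_. c) (Suc 0)" using 1(1) by (simp add: pol_def[abs_def])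
  ultimately show ?thesis using that r 1(2,3) by auto
qed

lemma Hzero_vec_no_atom:
  assumes "Jp = 0" "Jm = 0"
  shows "vec sp sm b n \<doteq> vec sp' sm' b n"
  using p.AE_pt_zero[of lam] m.AE_pt_zero[of lam] assms unfolding aeq_iff
  by (auto simp: pol_def elim!: eventually_mono)

end

section \<open>Multiplicities\<close>

lemma sum_pol_unit:
  "(\<Sum>k<n. u k * pol z (\<beta> k) (\<lambda>i. if i = k then 1 else 0) n t) = pol z (\<Sum>k<n. u k * \<beta> k) u n t"
proof -
  have "pol z (\<beta> k) (\<lambda>i. if i = k then 1 else 0) n t = \<beta> k * pt z t + rk z t ^ Suc k" if "k < n" for k
  proof -
    have "(\<Sum>i<n. (if i = k then 1 else 0) * rk z t ^ Suc i) = (\<Sum>i<n. if i = k then rk z t ^ Suc i else 0)"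
      by (intro sum.cong) auto
    then show ?thesis using that by (simp add: pol_def)
  qed
  then have "(\<Sum>k<n. u k * pol z (\<beta> k) (\<lambda>i. if i = k then 1 else 0) n t)
      = (\<Sum>k<n. (u k * \<beta> k) * pt z t + u k * rk z t ^ Suc k)"
    by (intro sum.cong) (auto simp: algebra_simps)
  then show ?thesis by (simp add: pol_def sum.distrib sum_distrib_right)
qed

section \<open>Eigenvectors in all cases, and root vectors where there is no atom\<close>

context coupling
begin

lemma infinite_p: "emeasure (dS Sp) UNIV = \<infinity>"
  using adm_p by (auto simp: admissible_def)

lemma alg_mult_ge_regular:
  assumes J: "Jp = 0" "Jm = 0" and ok: "\<And>j. j < n \<Longrightarrow> reg j \<and> Psi j = 0"
  shows "enat n \<le> alg_mult Sp Cp Sm Cm lam"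
  unfolding alg_mult_def
proof (rule Hdim_ge)
  define g where "g = (\<lambda>k. vec 0 0 (\<lambda>i. if i = k then 1 else 0) n)"
  show "rootvec Sp Cp Sm Cm lam (g k)" for k
  proof -
    have "Hvec Sp Sm (g k)" unfolding g_def by (rule Hvec_vec) (use ok in blast)
    moreover have "\<exists>w. (R ^^ Suc n) (g k) w \<and> Hzero Sp Sm w"
      unfolding g_def by (rule chain_vec) (use ok J in auto)
    ultimately show ?thesis unfolding rootvec_def by blast
  qed
  fix u k assume "Hzero Sp Sm (span_vec n u g)" "k < n"
  then have "AE t in dS Sp. pol lam 0 u n t = 0"
    using sum_pol_unit[of u lam "\<lambda>_. 0" n] by (simp add: span_vec_def g_def Hzero_def null_def)
  then show "u k = 0" using p.pol_eq_0(1)[OF infinite_p] \<open>k < n\<close> by blast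
qed

text \<open>Combinations of length n are closed under preimages. Since the lower \<open>Psi\<close>
  vanish, the coupling of a preimage says that its top coefficient times \<open>Psi n\<close> is 0,
  while a nonzero top coefficient needs \<open>reg n\<close>. If either condition fails, the top
  coefficient is 0.\<close>

lemma alg_mult_le_regular:
  assumes J: "Jp = 0" "Jm = 0" and ok: "\<And>j. j < n \<Longrightarrow> reg j \<and> Psi j = 0"
    and stop: "\<not> (reg n \<and> Psi n = 0)"
  shows "alg_mult Sp Cp Sm Cm lam \<le> enat n"
  unfolding alg_mult_def
proof (rule Hdim_le)
  define g where "g = (\<lambda>k. vec 0 0 (\<lambda>i. if i = k then 1 else 0) n)"
  fix x assume "rootvec Sp Cp Sm Cm lam x"
  then have "\<exists>sp sm b. x \<doteq> vec sp sm b n"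
  proof (rule rootvec_induct)
    fix x assume "Hzero Sp Sm x"
    then have "x \<doteq> vec 0 0 (\<lambda>_. 0) n" by (simp add: Hzero_def null_def Hdiff_def pol_def)
    then show "\<exists>sp sm b. x \<doteq> vec sp sm b n" by blast
  next
    fix x y assume "R x y" "\<exists>sp sm b. y \<doteq> vec sp sm b n"
    then obtain sp sm a where y: "R x y" "y \<doteq> vec sp sm a n" by blast
    obtain c sp' sm' where x: "x \<doteq> vec sp' sm' (case_nat c a) (Suc n)"
      and r: "(\<forall>i<n. case_nat c a i \<noteq> 0 \<longrightarrow> reg i) \<longrightarrow> case_nat c a n \<noteq> 0 \<longrightarrow> reg n"
      and G: "(\<forall>i\<le>n. case_nat c a i \<noteq> 0 \<longrightarrow> reg i) \<longrightarrow>
         sp' * Jp - sm' * Jm + (\<Sum>i<Suc n. case_nat c a i * Psi i) = 0"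
      using Ashift_resolve[OF y] by blast
    have r': "case_nat c a n \<noteq> 0 \<longrightarrow> reg n" using r ok by blast
    have "\<forall>i\<le>n. case_nat c a i \<noteq> 0 \<longrightarrow> reg i" using r' ok by (metis le_neq_implies_less)
    then have "(\<Sum>i<Suc n. case_nat c a i * Psi i) = 0" using G J by simp
    then have "case_nat c a n * Psi n = 0" using ok by simp
    then have "case_nat c a n = 0" using r' stop by auto
    then have "x \<doteq> vec sp' sm' (case_nat c a) n" using x by (simp only: vec_zero_coeff)
    then show "\<exists>sp sm b. x \<doteq> vec sp sm b n" by blast
  qed
  then obtain sp sm b where "x \<doteq> vec sp sm b n" by blast
  then have "x \<doteq> vec 0 0 b n" by (rule aeq_trans) (rule Hzero_vec_no_atom[OF J])
  moreover have "span_vec n b g = vec 0 0 b n"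
    using sum_pol_unit[of b lam "\<lambda>_. 0" n] by (simp add: span_vec_def g_def)
  ultimately show "\<exists>u. x \<doteq> span_vec n u g" by metis
qed

lemma sigma_p_regular:
  assumes J: "Jp = 0" "Jm = 0" and reg: "reg 0"
  shows "lam \<in> sigma_p_Ahat Sp Cp Sm Cm \<longleftrightarrow> Psi 0 = 0"
    and "Psi 0 = 0 \<Longrightarrow> geom_mult Sp Cp Sm Cm lam = 1"
proof -
  have eig: "eigvec Sp Cp Sm Cm lam (vec 0 0 (\<lambda>_. 1) (Suc 0))" if "Psi 0 = 0"
  proof -
    have "R (vec 0 0 (\<lambda>_. 1) (Suc 0)) (vec (- 1) (- 1) (\<lambda>_. 1) 0)"
      by (rule Ashift_vec) (use reg that J in auto)
    moreover have "Hzero Sp Sm (vec (- 1) (- 1) (\<lambda>_. 1) 0)"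
      using Hzero_aeq[OF Hzero_vec_no_atom[OF J]] Hzero_vec0 by blast
    moreover have "Hvec Sp Sm (vec 0 0 (\<lambda>_. 1) (Suc 0))" by (rule Hvec_vec) (use reg in auto)
    ultimately show ?thesis unfolding eigvec_def by blast
  qed
  have nz: "\<not> Hzero Sp Sm (vec 0 0 (\<lambda>_. 1) (Suc 0))"
    using p.pol_eq_0(1)[OF infinite_p, of lam 0 "\<lambda>_. 1" "Suc 0" 0] by (auto simp: Hzero_def null_def)
  show "lam \<in> sigma_p_Ahat Sp Cp Sm Cm \<longleftrightarrow> Psi 0 = 0"
  proof
    assume "lam \<in> sigma_p_Ahat Sp Cp Sm Cm"
    then obtain x where x: "eigvec Sp Cp Sm Cm lam x" "\<not> Hzero Sp Sm x" by (auto simp: sigma_p_Ahat_def)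
    obtain c sp sm where c: "x \<doteq> vec sp sm (\<lambda>_. c) (Suc 0)" "sp * Jp - sm * Jm + c * Psi 0 = 0"
      using eigvec_resolve[OF x(1)] by metis
    have "x \<doteq> vec 0 0 (\<lambda>_. c) (Suc 0)" using aeq_trans[OF c(1) Hzero_vec_no_atom[OF J]] .
    then have "\<not> Hzero Sp Sm (vec 0 0 (\<lambda>_. c) (Suc 0))" using x(2) Hzero_aeq by blast
    then have "c \<noteq> 0" by (auto simp: pol_def Hzero_def null_def)
    then show "Psi 0 = 0" using c(2) J by simp
  next
    assume "Psi 0 = 0"
    then show "lam \<in> sigma_p_Ahat Sp Cp Sm Cm" using eig nz unfolding sigma_p_Ahat_def by blast
  qed
  assume Psi: "Psi 0 = 0"
  have "enat 1 \<le> geom_mult Sp Cp Sm Cm lam" unfolding geom_mult_def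
  proof (rule Hdim_ge)
    show "eigvec Sp Cp Sm Cm lam (vec 0 0 (\<lambda>_. 1) (Suc 0))" by (rule eig[OF Psi])
    fix u :: "nat \<Rightarrow> complex" and k :: nat
    assume "Hzero Sp Sm (span_vec 1 u (\<lambda>_. vec 0 0 (\<lambda>_. 1) (Suc 0)))" "k < 1"
    then have "AE t in dS Sp. pol lam 0 u (Suc 0) t = 0"
      by (auto simp: span_vec_def Hzero_def null_def pol_def)
    then show "u k = 0" using p.pol_eq_0(1)[OF infinite_p] \<open>k < 1\<close> by simp
  qed
  moreover have "geom_mult Sp Cp Sm Cm lam \<le> enat 1" unfolding geom_mult_def
  proof (rule Hdim_le)
    fix x assume x: "eigvec Sp Cp Sm Cm lam x"
    obtain c sp sm where c: "x \<doteq> vec sp sm (\<lambda>_. c) (Suc 0)"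
      using eigvec_resolve[OF x(1)] by metis
    have "x \<doteq> vec 0 0 (\<lambda>_. c) (Suc 0)" using aeq_trans[OF c(1) Hzero_vec_no_atom[OF J]] .
    also have "vec 0 0 (\<lambda>_. c) (Suc 0) = span_vec 1 (\<lambda>_. c) (\<lambda>_. vec 0 0 (\<lambda>_. 1) (Suc 0))"
      by (simp add: span_vec_def pol_def[abs_def])
    finally show "\<exists>u. x \<doteq> span_vec 1 u (\<lambda>_. vec 0 0 (\<lambda>_. 1) (Suc 0))" by blast
  qed
  ultimately show "geom_mult Sp Cp Sm Cm lam = 1" by (simp add: one_enat_def)
qed

text \<open>Both negative cases of the theorem at once. The coefficient c of the kernel vanishes,
  for lack of square integrability or because of an atom. The coupling then equates the weighted
  point masses, and one of them is 0, so the vector is null.\<close>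

lemma not_sigma_p:
  assumes one: "Jp = 0 \<or> Jm = 0" and bad: "\<not> reg 0 \<or> Jp \<noteq> 0 \<or> Jm \<noteq> 0"
  shows "lam \<notin> sigma_p_Ahat Sp Cp Sm Cm"
proof
  assume "lam \<in> sigma_p_Ahat Sp Cp Sm Cm"
  then obtain x where x: "eigvec Sp Cp Sm Cm lam x" "\<not> Hzero Sp Sm x" by (auto simp: sigma_p_Ahat_def)
  obtain c sp sm where c: "x \<doteq> vec sp sm (\<lambda>_. c) (Suc 0)" "sp * Jp - sm * Jm + c * Psi 0 = 0"
    "Jp \<noteq> 0 \<or> Jm \<noteq> 0 \<Longrightarrow> c = 0" "c \<noteq> 0 \<Longrightarrow> reg 0"
    using eigvec_resolve[OF x(1)] by metis
  have c0: "c = 0" using bad c(3,4) by blast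
  then have "sp * Jp = sm * Jm" using c(2) by simp
  then have sJ: "sp * Jp = 0" "sm * Jm = 0" using one by auto
  have "AE t in dS Sp. sp * pt lam t = 0"
    using sJ(1) p.AE_pt_zero[of lam] by (cases "sp = 0") auto
  moreover have "AE t in dS Sm. sm * pt lam t = 0"
    using sJ(2) m.AE_pt_zero[of lam] by (cases "sm = 0") auto
  ultimately have "Hzero Sp Sm (vec sp sm (\<lambda>_. c) (Suc 0))"
    unfolding c0 by (simp add: Hzero_def null_def pol_def)
  then show False using x(2) Hzero_aeq[OF c(1)] by blast
qed

text \<open>Any eigenvector is a pure point mass, as the atoms exclude the kernel. The masses 1 /
  \<open>Jp\<close> and 1 / \<open>Jm\<close> make both values of \<open>\<Gamma>\<^sub>1\<close>
  equal to 1. Without equal atoms or without \<open>reg 0\<close>, this eigenvector has no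
  preimage.\<close>

lemma sigma_p_atoms:
  assumes J: "Jp \<noteq> 0" "Jm \<noteq> 0"
  shows "lam \<in> sigma_p_Ahat Sp Cp Sm Cm" and "geom_mult Sp Cp Sm Cm lam = 1"
    and "\<not> (Jp = Jm \<and> reg 0) \<Longrightarrow> alg_mult Sp Cp Sm Cm lam = 1"
proof -
  define g where "g = vec (1 / Jp) (1 / Jm) (\<lambda>_. 0) 0"
  have eig: "eigvec Sp Cp Sm Cm lam g" unfolding g_def by (rule eigvec_vec0) (use J in simp)
  have span: "span_vec 1 u (\<lambda>_. g) = vec (u 0 / Jp) (u 0 / Jm) (\<lambda>_. 0) 0" for u
    by (simp add: span_vec_def g_def pol_def[abs_def])
  have indep: "u k = 0" if "Hzero Sp Sm (span_vec 1 u (\<lambda>_. g))" "k < 1" for u and k :: nat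
  proof -
    have "AE t in dS Sp. pol lam (u 0 / Jp) (\<lambda>_. 0) 0 t = 0"
      using that(1) unfolding span by (simp add: Hzero_def null_def)
    from p.pol_eq_0(2)[OF infinite_p this] show ?thesis using J that(2) by simp
  qed
  have in_span: "\<exists>u. x \<doteq> span_vec 1 u (\<lambda>_. g)" if "x \<doteq> vec sp sm b 0" "sp * Jp = sm * Jm" for x sp sm b
  proof -
    have "vec sp sm b 0 = span_vec 1 (\<lambda>_. sp * Jp) (\<lambda>_. g)"
    proof -
      have "sp * Jp / Jp = sp" using J by simp
      moreover have "sp * Jp / Jm = sm" using J unfolding that(2) by simp
      ultimately show ?thesis unfolding span by (simp add: pol_def[abs_def])
    qed
    then show ?thesis using that(1) by metis
  qed
  have "\<not> Hzero Sp Sm g"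
    using p.pol_eq_0(2)[OF infinite_p, of lam "1/Jp" "\<lambda>_. 0" 0] J by (auto simp: g_def Hzero_def null_def)
  then show "lam \<in> sigma_p_Ahat Sp Cp Sm Cm" using eig unfolding sigma_p_Ahat_def by blast
  have "enat 1 \<le> geom_mult Sp Cp Sm Cm lam" unfolding geom_mult_def
    by (rule Hdim_ge[where g = "\<lambda>_. g"]) (use eig indep in auto)
  moreover have "geom_mult Sp Cp Sm Cm lam \<le> enat 1" unfolding geom_mult_def
  proof (rule Hdim_le)
    fix x assume x: "eigvec Sp Cp Sm Cm lam x"
    obtain c sp sm where c: "x \<doteq> vec sp sm (\<lambda>_. c) (Suc 0)" "sp * Jp - sm * Jm + c * Psi 0 = 0" "c = 0"
      using eigvec_resolve[OF x(1)] J by metis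
    have "x \<doteq> vec sp sm (\<lambda>_. c) 0" using c(1,3) by (simp only: vec_zero_coeff)
    then show "\<exists>u. x \<doteq> span_vec 1 u (\<lambda>_. g)" by (rule in_span) (use c(2,3) in simp)
  qed
  ultimately show "geom_mult Sp Cp Sm Cm lam = 1" by (simp add: one_enat_def)
  assume bad: "\<not> (Jp = Jm \<and> reg 0)"
  have "enat 1 \<le> alg_mult Sp Cp Sm Cm lam" unfolding alg_mult_def
    by (rule Hdim_ge[where g = "\<lambda>_. g"]) (use eigvec_imp_rootvec[OF eig] indep in auto)
  moreover have "alg_mult Sp Cp Sm Cm lam \<le> enat 1" unfolding alg_mult_def
  proof (rule Hdim_le)
    fix x assume "rootvec Sp Cp Sm Cm lam x"
    then have "\<exists>sp sm b. x \<doteq> vec sp sm b 0 \<and> sp * Jp = sm * Jm"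
    proof (rule rootvec_induct)
      fix x assume "Hzero Sp Sm x"
      then have "x \<doteq> vec 0 0 (\<lambda>_. 0) 0" by (rule Hzero_imp_aeq)
      then show "\<exists>sp sm b. x \<doteq> vec sp sm b 0 \<and> sp * Jp = sm * Jm" by (metis mult_zero_left)
    next
      fix x y assume "R x y" "\<exists>sp sm b. y \<doteq> vec sp sm b 0 \<and> sp * Jp = sm * Jm"
      then obtain sp sm a where y: "R x y" "y \<doteq> vec sp sm a 0" and s: "sp * Jp = sm * Jm" by blast
      obtain c sp' sm' where x: "x \<doteq> vec sp' sm' (case_nat c a) (Suc 0)"
        and sc: "Jp \<noteq> 0 \<longrightarrow> sp = - c" "Jm \<noteq> 0 \<longrightarrow> sm = - c"
        and r: "(\<forall>i<0. case_nat c a i \<noteq> 0 \<longrightarrow> reg i) \<longrightarrow> case_nat c a 0 \<noteq> 0 \<longrightarrow> reg 0"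
        and G: "(\<forall>i\<le>0. case_nat c a i \<noteq> 0 \<longrightarrow> reg i) \<longrightarrow>
           sp' * Jp - sm' * Jm + (\<Sum>i<Suc 0. case_nat c a i * Psi i) = 0"
        using Ashift_resolve[OF y] by blast
      \<comment> \<open>Both masses of y equal - c, so \<open>s\<close> gives c \<open>Jp\<close> =
        c \<open>Jm\<close>. A nonzero c would thus give equal atoms, and \<open>r\<close> would
        give \<open>reg 0\<close>.\<close>
      have c0: "c = 0" using r sc s J bad by auto
      then have "x \<doteq> vec sp' sm' (case_nat c a) 0" using x by (simp add: pol_zero_coeff)
      moreover have "sp' * Jp = sm' * Jm" using G c0 by simp
      ultimately show "\<exists>sp sm b. x \<doteq> vec sp sm b 0 \<and> sp * Jp = sm * Jm" by blast
    qed
    then show "\<exists>u. x \<doteq> span_vec 1 u (\<lambda>_. g)" using in_span by blast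
  qed
  ultimately show "alg_mult Sp Cp Sm Cm lam = 1" by (simp add: one_enat_def)
qed

section \<open>Root vectors at a common atom of equal mass\<close>

context
  fixes m :: nat
  assumes J: "Jp = Jm" "Jm \<noteq> 0"
    and ok: "\<And>j. j < m \<Longrightarrow> Psi j = 0" and reg_m: "reg m"
begin

text \<open>The last vector of the basis only satisfies the coupling of the \<open>\<Gamma>\<^sub>1\<close> after a point mass has
  been added on one side.\<close>

definition correction :: "nat \<Rightarrow> complex" where
  "correction k = (if k = m then Psi m / Jm else 0)"

definition basis :: "nat \<Rightarrow> hvec" where
  "basis = case_nat (vec 1 1 (\<lambda>_. 0) (Suc m))
     (\<lambda>k. vec 0 (correction k) (\<lambda>i. if i = k then 1 else 0) (Suc m))"

text \<open>The second mass is the solution sm of (sp - sm) \<open>Jm\<close> + b m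
  \<open>Psi m\<close> = 0, so the basis spans precisely the combinations of length m + 1 that
  satisfy this equation. Of m + 3 parameters m + 2 remain.\<close>

lemma span_basis:
  "span_vec (Suc (Suc m)) u basis
     = vec (u 0) (u 0 + u (Suc m) * (Psi m / Jm)) (\<lambda>i. u (Suc i)) (Suc m)"
proof -
  have 1: "(\<Sum>i<Suc (Suc m). u i * fst (basis i) t) = pol lam (u 0) (\<lambda>i. u (Suc i)) (Suc m) t" for t
  proof -
    have "(\<Sum>i<Suc (Suc m). u i * fst (basis i) t)
        = u 0 * pt lam t + (\<Sum>k<Suc m. u (Suc k) * pol lam 0 (\<lambda>i. if i = k then 1 else 0) (Suc m) t)"
      by (subst sum.lessThan_Suc_shift) (simp add: basis_def pol_def[of lam 1])
    also have "\<dots> = pol lam (u 0) (\<lambda>i. u (Suc i)) (Suc m) t"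
      using sum_pol_unit[of "\<lambda>i. u (Suc i)" lam "\<lambda>_. 0" "Suc m" t] by (simp add: pol_def)
    finally show ?thesis .
  qed
  have 2: "(\<Sum>i<Suc (Suc m). u i * snd (basis i) t)
      = pol lam (u 0 + u (Suc m) * (Psi m / Jm)) (\<lambda>i. u (Suc i)) (Suc m) t" for t
  proof -
    have "(\<Sum>i<Suc (Suc m). u i * snd (basis i) t)
        = u 0 * pt lam t + (\<Sum>k<Suc m. u (Suc k) * pol lam (correction k) (\<lambda>i. if i = k then 1 else 0) (Suc m) t)"
      by (subst sum.lessThan_Suc_shift) (simp add: basis_def pol_def[of lam 1])
    also have "\<dots> = u 0 * pt lam t + pol lam (\<Sum>k<Suc m. u (Suc k) * correction k) (\<lambda>i. u (Suc i)) (Suc m) t"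
      by (simp only: sum_pol_unit)
    also have "(\<Sum>k<Suc m. u (Suc k) * correction k) = u (Suc m) * (Psi m / Jm)"
      by (simp add: correction_def)
    finally show ?thesis by (simp add: pol_def algebra_simps)
  qed
  show ?thesis unfolding span_vec_def 1 2 by simp
qed

text \<open>As \<open>Psi j = 0\<close> for j < m, the hypothesis is the whole coupling condition.
  After one step the masses agree and the length is m, so \<open>Psi m\<close> does not occur
  again.\<close>

lemma root_vec_atoms:
  assumes "(sp - sm) * Jm + b m * Psi m = 0"
  shows "rootvec Sp Cp Sm Cm lam (vec sp sm b (Suc m))"
proof -
  have reg: "reg i" if "i \<le> m" for i using reg_mono[OF reg_m that] .
  have "(\<Sum>i<Suc m. b i * Psi i) = b m * Psi m" using ok by simp
  then have "R (vec sp sm b (Suc m)) (vec (- b 0) (- b 0) (\<lambda>i. b (Suc i)) m)"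
    using assms J reg by (intro Ashift_vec) (auto simp: algebra_simps simp del: sum.lessThan_Suc)
  moreover obtain w where "(R ^^ Suc m) (vec (- b 0) (- b 0) (\<lambda>i. b (Suc i)) m) w" "Hzero Sp Sm w"
    using chain_vec[OF J(1), of m "- b 0" "\<lambda>i. b (Suc i)"] ok reg by auto
  moreover have "Hvec Sp Sm (vec sp sm b (Suc m))" by (rule Hvec_vec) (use reg in auto)
  ultimately show ?thesis using rootvec_step by blast
qed

lemma alg_mult_ge_atoms: "enat (Suc (Suc m)) \<le> alg_mult Sp Cp Sm Cm lam"
  unfolding alg_mult_def
proof (rule Hdim_ge)
  fix k assume "k < Suc (Suc m)"
  show "rootvec Sp Cp Sm Cm lam (basis k)"
  proof (cases k)
    case 0
    have "rootvec Sp Cp Sm Cm lam (vec 1 1 (\<lambda>_. 0) (Suc m))" by (rule root_vec_atoms) simp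
    then show ?thesis using 0 by (simp add: basis_def)
  next
    case (Suc i)
    have "rootvec Sp Cp Sm Cm lam (vec 0 (correction i) (\<lambda>j. if j = i then 1 else 0) (Suc m))"
      by (rule root_vec_atoms) (use J in \<open>simp add: correction_def\<close>)
    then show ?thesis using Suc by (simp add: basis_def)
  qed
next
  fix u k assume "Hzero Sp Sm (span_vec (Suc (Suc m)) u basis)" and k: "k < Suc (Suc m)"
  then have "AE t in dS Sp. pol lam (u 0) (\<lambda>i. u (Suc i)) (Suc m) t = 0"
    unfolding span_basis by (simp add: Hzero_def null_def)
  from p.pol_eq_0[OF infinite_p this] have "u 0 = 0" "\<And>i. i < Suc m \<Longrightarrow> u (Suc i) = 0"
    using J by auto
  then show "u k = 0" using k by (cases k) auto
qed

text \<open>The invariant \<open>Q\<close> allows unequal masses compensated by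
  \<open>Psi m\<close>. A vector that has a preimage must have equal masses, whence a m
  \<open>Psi m\<close> = 0; moreover a m becomes the coefficient of the power m + 2 in the preimage,
  which needs \<open>reg (Suc m)\<close>. By \<open>stop\<close> it vanishes, and the preimage has
  length m + 1 again.\<close>

lemma alg_mult_le_atoms:
  assumes stop: "\<not> (reg (Suc m) \<and> Psi m = 0)"
  shows "alg_mult Sp Cp Sm Cm lam \<le> enat (Suc (Suc m))"
  unfolding alg_mult_def
proof (rule Hdim_le)
  define Q where "Q = (\<lambda>x. \<exists>sp sm b. x \<doteq> vec sp sm b (Suc m) \<and> (sp - sm) * Jm + b m * Psi m = 0)"
  have reg: "reg i" if "i \<le> m" for i using reg_mono[OF reg_m that] .
  fix x assume "rootvec Sp Cp Sm Cm lam x"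
  then have "Q x"
  proof (rule rootvec_induct)
    fix x assume "Hzero Sp Sm x"
    then have "x \<doteq> vec 0 0 (\<lambda>_. 0) (Suc m)" by (simp add: Hzero_def null_def Hdiff_def pol_def)
    moreover have "(0 - 0) * Jm + (\<lambda>_. 0) m * Psi m = 0" by simp
    ultimately show "Q x" unfolding Q_def by blast
  next
    fix x y assume "R x y" "Q y"
    then obtain sp sm a where y: "R x y" "y \<doteq> vec sp sm a (Suc m)"
      and s: "(sp - sm) * Jm + a m * Psi m = 0" unfolding Q_def by blast
    obtain c sp' sm' where x: "x \<doteq> vec sp' sm' (case_nat c a) (Suc (Suc m))"
      and sc: "Jp \<noteq> 0 \<longrightarrow> sp = - c" "Jm \<noteq> 0 \<longrightarrow> sm = - c"
      and r: "(\<forall>i<Suc m. case_nat c a i \<noteq> 0 \<longrightarrow> reg i) \<longrightarrow> case_nat c a (Suc m) \<noteq> 0 \<longrightarrow> reg (Suc m)"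
      and G: "(\<forall>i\<le>Suc m. case_nat c a i \<noteq> 0 \<longrightarrow> reg i) \<longrightarrow>
         sp' * Jp - sm' * Jm + (\<Sum>i<Suc (Suc m). case_nat c a i * Psi i) = 0"
      using Ashift_resolve[OF y] by blast
    have am: "a m = 0"
    proof (rule ccontr)
      assume "a m \<noteq> 0"
      moreover have "a m * Psi m = 0" using s sc J by simp
      moreover have "a m \<noteq> 0 \<longrightarrow> reg (Suc m)" using r reg by (auto simp: less_Suc_eq_le)
      ultimately show False using stop by simp
    qed
    have "\<forall>i\<le>Suc m. case_nat c a i \<noteq> 0 \<longrightarrow> reg i"
      using reg am by (auto simp: le_Suc_eq split: nat.splits)
    then have "sp' * Jp - sm' * Jm + (\<Sum>i<Suc (Suc m). case_nat c a i * Psi i) = 0" using G by blast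
    moreover have "(\<Sum>i<Suc (Suc m). case_nat c a i * Psi i) = case_nat c a m * Psi m"
      using am ok by simp
    ultimately have "(sp' - sm') * Jm + case_nat c a m * Psi m = 0"
      using J by (simp add: left_diff_distrib del: sum.lessThan_Suc)
    moreover have "x \<doteq> vec sp' sm' (case_nat c a) (Suc m)"
      using x am by (simp add: pol_zero_coeff)
    ultimately show "Q x" unfolding Q_def by blast
  qed
  then obtain sp sm b where x: "x \<doteq> vec sp sm b (Suc m)" and s: "(sp - sm) * Jm + b m * Psi m = 0"
    unfolding Q_def by blast
  have "sm = sp + b m * (Psi m / Jm)" using s J by (simp add: field_simps)
  then have "x \<doteq> span_vec (Suc (Suc m)) (case_nat sp b) basis"
    unfolding span_basis using x by simp
  then show "\<exists>u. x \<doteq> span_vec (Suc (Suc m)) u basis" by blast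
qed

end

end

section \<open>Identification with the data of the theorem\<close>

lemma enat_le_iff_initial_segment:
  assumes ge: "\<And>m. (\<forall>j<m. C j) \<Longrightarrow> enat (m + s) \<le> D"
    and le: "\<And>m. (\<forall>j<m. C j) \<Longrightarrow> \<not> C m \<Longrightarrow> D \<le> enat (m + s)"
  shows "enat (n + s) \<le> D \<longleftrightarrow> (\<forall>j<n. C j)"
proof
  assume n: "enat (n + s) \<le> D"
  show "\<forall>j<n. C j"
  proof (rule ccontr)
    assume "\<not> ?thesis"
    then obtain j where j: "j < n" "\<not> C j" by blast
    define i where "i = (LEAST j. \<not> C j)"
    have i: "\<not> C i" "i \<le> j"
      unfolding i_def using LeastI[of "\<lambda>j. \<not> C j", OF j(2)] Least_le[of "\<lambda>j. \<not> C j", OF j(2)] .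
    have "\<forall>j<i. C j" unfolding i_def using not_less_Least by blast
    from le[OF this i(1)] n have "enat (n + s) \<le> enat (i + s)" by (rule order_trans[rotated])
    then show False using i(2) j(1) by simp
  qed
qed (rule ge, simp)

text \<open>The hypotheses say that D is s plus the number of consecutive indices from 0 on at which
  \<open>C\<close> holds, possibly infinite. This is the shape of both multiplicity formulas, with s
  = 2 at common atoms and s = 0 without atoms.\<close>

lemma Greatest_enat_initial_segment:
  assumes ge: "\<And>m. (\<forall>j<m. C j) \<Longrightarrow> enat (m + s) \<le> D"
    and le: "\<And>m. (\<forall>j<m. C j) \<Longrightarrow> \<not> C m \<Longrightarrow> D \<le> enat (m + s)"
    and Q: "\<And>k. Q k \<longleftrightarrow> enat a \<le> k \<and> (\<forall>j. enat (j + s) < k \<longrightarrow> C j)" and a: "enat a \<le> D"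
  shows "(GREATEST k. Q k) = D"
proof (rule Greatest_equality)
  have iff: "enat (n + s) \<le> D \<longleftrightarrow> (\<forall>j<n. C j)" for n
    by (rule enat_le_iff_initial_segment) (erule ge, erule (1) le)
  show "Q D" unfolding Q
  proof (intro conjI allI impI a)
    fix j assume "enat (j + s) < D"
    then have "enat (Suc j + s) \<le> D" by (simp add: Suc_ile_eq)
    then have "\<forall>i<Suc j. C i" by (simp only: iff)
    then show "C j" by simp
  qed
  fix y assume "Q y"
  then have y: "\<And>j. enat (j + s) < y \<Longrightarrow> C j" unfolding Q by blast
  show "y \<le> D"
  proof (cases y)
    case (enat n)
    \<comment> \<open>With truncated subtraction n - s + s is the maximum of n and s, so it bounds n
      in any case.\<close>
    have "enat (n - s + s) \<le> D" unfolding iff using y enat by auto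
    then show ?thesis unfolding enat by (rule order_trans[rotated]) simp
  next
    case infinity
    then have "enat (n + s) \<le> D" for n unfolding iff using y by simp
    then have "D \<noteq> enat d" for d
      by (metis enat_ord_simps(1) le_add1 Suc_n_not_le_n add_Suc order_trans)
    then show ?thesis by (cases D) auto
  qed
qed

lemma all_ge_iff:
  fixes s :: nat
  shows "(\<forall>j. s \<le> j \<and> P j \<longrightarrow> Q j) \<longleftrightarrow> (\<forall>j. P (j + s) \<longrightarrow> Q (j + s))"
proof safe
  fix j assume "\<forall>j. P (j + s) \<longrightarrow> Q (j + s)" "s \<le> j" "P j"
  then show "Q j" by (auto dest: spec[of _ "j - s"])
qed simp

context weighted_measure
begin

text \<open>At t = z the inverse is infinite in \<open>ennreal\<close> but 0 in the complex numbers;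
  the indicator brings the two conventions into line.\<close>

lemma nn_integral_rk_power_finite_iff:
  "(\<integral>\<^sup>+ t. indicator {t. complex_of_real t \<noteq> z} t *
      inverse (ennreal (cmod (complex_of_real t - z))) ^ (2 * Suc j) \<partial>M) < \<infinity>
    \<longleftrightarrow> L2 M (\<lambda>t. rk z t ^ Suc j)"
proof -
  have "indicator {t. complex_of_real t \<noteq> z} t * inverse (ennreal (cmod (complex_of_real t - z))) ^ (2 * Suc j)
      = ennreal (norm ((cmod (rk z t ^ Suc j))\<^sup>2))" for t
  proof (cases "complex_of_real t = z")
    case False
    then show ?thesis
      by (simp add: rk_def inverse_ennreal ennreal_power norm_power norm_inverse power_mult[symmetric]
          mult.commute indicator_def del: power_Suc mult_Suc_right mult_Suc)
  qed (simp add: rk_def)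
  then show ?thesis unfolding L2_def integrable_iff_bounded by simp
qed

end

context coupling
begin

abbreviation Phi :: "complex \<Rightarrow> complex" where
  "Phi \<equiv> (\<lambda>z. M_fun Sp Cp z - M_fun Sm Cm z)"

lemma negmom'_iff: "negmom' Sp lam (Suc j) < \<infinity> \<and> negmom' Sm lam (Suc j) < \<infinity> \<longleftrightarrow> reg j"
  unfolding negmom'_def reg_def p.nn_integral_rk_power_finite_iff m.nn_integral_rk_power_finite_iff ..

text \<open>\<open>deriv\<close> depends on a whole neighbourhood, so the formula of the induction
  hypothesis is used on the open set of nonreal points.\<close>

lemma iterated_deriv_Phi:
  "Im z \<noteq> 0 \<Longrightarrow> (deriv ^^ j) Phi z = fact j * (mom (dS Sp) Cp z j - mom (dS Sm) Cm z j)"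
proof (induction j arbitrary: z)
  case 0
  then show ?case by (simp add: mom_def M_fun_def rk_def)
next
  case (Suc j)
  define G where "G = (\<lambda>w. fact j * (mom (dS Sp) Cp w j - mom (dS Sm) Cm w j))"
  have "open {w. Im w \<noteq> 0}" by (rule open_Collect_neq) (auto intro!: continuous_intros)
  then have "\<forall>\<^sub>F w in nhds z. w \<in> {w. Im w \<noteq> 0}" using Suc.prems by (intro eventually_nhds_in_open) auto
  then have "\<forall>\<^sub>F w in nhds z. (deriv ^^ j) Phi w = G w"
    by eventually_elim (simp add: Suc.IH G_def)
  then have "deriv ((deriv ^^ j) Phi) z = deriv G z" by (rule deriv_cong_ev) simp
  moreover have "(G has_field_derivative
      fact j * (of_nat (Suc j) * mom (dS Sp) Cp z (Suc j) - of_nat (Suc j) * mom (dS Sm) Cm z (Suc j))) (at z)"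
    unfolding G_def
    by (intro DERIV_cmult DERIV_diff p.mom_has_derivative m.mom_has_derivative Suc.prems)
  then have "deriv G z = fact j * (of_nat (Suc j) * mom (dS Sp) Cp z (Suc j) - of_nat (Suc j) * mom (dS Sm) Cm z (Suc j))"
    by (rule DERIV_imp_deriv)
  moreover have "fact j * (of_nat (Suc j) * x - of_nat (Suc j) * y) = fact (Suc j) * (x - y)" for x y :: complex
    unfolding fact_Suc by (simp only: right_diff_distrib mult.assoc mult.left_commute)
  ultimately show ?case by (simp only: funpow.simps comp_apply)
qed

text \<open>The shares of the two atoms in the moments may be unbounded as e tends to 0, but with
  equal atoms they are identical and drop out of the difference. The limit is then
  \<open>Psi j\<close> up to a factorial.\<close>

lemma vlim0_iff:
  assumes J: "Jp = Jm" and reg: "reg j"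
  shows "vlim0 ((deriv ^^ j) Phi) lam \<longleftrightarrow> Psi j = 0"
proof -
  let ?l = "\<lambda>e::real. lam + \<i> * complex_of_real e"
  have "((\<lambda>e. fact j * ((mom (dS Sp) Cp (?l e) j - inverse (- (\<i> * complex_of_real e)) ^ Suc j * Jp)
      - (mom (dS Sm) Cm (?l e) j - inverse (- (\<i> * complex_of_real e)) ^ Suc j * Jm)))
      \<longlongrightarrow> fact j * Psi j) (at 0)"
    unfolding Psi_def using reg
    by (intro tendsto_mult tendsto_const tendsto_diff p.mom_boundary m.mom_boundary) (auto simp: reg_def)
  moreover have "\<forall>\<^sub>F e in at 0. fact j * ((mom (dS Sp) Cp (?l e) j - inverse (- (\<i> * complex_of_real e)) ^ Suc j * Jp)
      - (mom (dS Sm) Cm (?l e) j - inverse (- (\<i> * complex_of_real e)) ^ Suc j * Jm)) = (deriv ^^ j) Phi (?l e)"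
    using p.eventually_near_axis[of lam]
  proof eventually_elim
    case (elim e)
    then have "Im (?l e) \<noteq> 0" by blast
    then show ?case unfolding J
      by (subst iterated_deriv_Phi) (assumption, simp only: diff_diff_eq2 diff_add_cancel)
  qed
  ultimately have lim: "((\<lambda>e. (deriv ^^ j) Phi (?l e)) \<longlongrightarrow> fact j * Psi j) (at 0)"
    by (rule Lim_transform_eventually)
  show ?thesis
  proof
    assume "vlim0 ((deriv ^^ j) Phi) lam"
    then have "fact j * Psi j = 0"
      unfolding vlim0_def by (rule tendsto_unique[OF at_neq_bot lim])
    then show "Psi j = 0" by simp
  next
    assume "Psi j = 0"
    then show "vlim0 ((deriv ^^ j) Phi) lam" using lim unfolding vlim0_def by simp
  qed
qed

end

section \<open>Eigenvalues of Q and atoms\<close>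

context weighted_measure
begin

lemma eigen_iff_atom:
  "(\<exists>f. domQ M f \<and> \<not> null M f \<and> null M (\<lambda>t. (complex_of_real t - z) * f t)) \<longleftrightarrow> atom M z \<noteq> 0"
proof
  assume "\<exists>f. domQ M f \<and> \<not> null M f \<and> null M (\<lambda>t. (complex_of_real t - z) * f t)"
  then obtain f where f: "\<not> null M f" "null M (\<lambda>t. (complex_of_real t - z) * f t)" by blast
  show "atom M z \<noteq> 0"
  proof
    assume "atom M z = 0"
    then have "AE t in M. pt z t = 0" by (rule AE_pt_zero)
    then have "AE t in M. f t = 0" using f(2) unfolding null_def
      by eventually_elim (auto simp: pt_def split: if_splits)
    then show False using f(1) by (simp add: null_def)
  qed
next
  assume nz: "atom M z \<noteq> 0"
  have "\<not> null M (pt z)"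
  proof
    assume "null M (pt z)"
    then show False using AE_atomD[OF _ nz, of "\<lambda>t. pt z t = 0"] unfolding null_def by (auto simp: pt_def)
  qed
  moreover have "null M (\<lambda>t. (complex_of_real t - z) * pt z t)" by (simp add: null_def pt_mult)
  ultimately show "\<exists>f. domQ M f \<and> \<not> null M f \<and> null M (\<lambda>t. (complex_of_real t - z) * f t)"
    using domQ_pt by blast
qed

end

lemma weighted_measure_dS: "admissible S \<Longrightarrow> weighted_measure (dS S)"
  by unfold_locales (auto simp: admissible_def dS_def)

lemma sigma_p_Q_iff: "admissible S \<Longrightarrow> z \<in> sigma_p_Q S \<longleftrightarrow> atom (dS S) z \<noteq> 0"
  unfolding sigma_p_Q_def using weighted_measure.eigen_iff_atom[OF weighted_measure_dS] by simp

text \<open>The integrands can differ at t = z only, a point without mass when z is no eigenvalue of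
  Q.\<close>

lemma negmom_eq_negmom':
  assumes "admissible S" "z \<notin> sigma_p_Q S"
  shows "negmom S z j = negmom' S z j"
proof -
  have "atom (dS S) z = 0" using assms sigma_p_Q_iff by blast
  then have "AE t in dS S. pt z t = 0"
    by (rule weighted_measure.AE_pt_zero[OF weighted_measure_dS[OF assms(1)]])
  then have "AE t in dS S. inverse (ennreal (cmod (complex_of_real t - z))) ^ (2 * j)
      = indicator {t. complex_of_real t \<noteq> z} t * inverse (ennreal (cmod (complex_of_real t - z))) ^ (2 * j)"
    by eventually_elim (auto simp: pt_def split: if_splits)
  then show ?thesis unfolding negmom_def negmom'_def by (rule nn_integral_cong_AE)
qed

lemma atom_eq_jump:
  assumes "admissible S" "z \<in> sigma_p_Q S"
  shows "atom (dS S) z = jump S (Re z)"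
proof -
  have "atom (dS S) z \<noteq> 0" using assms sigma_p_Q_iff by blast
  then have "complex_of_real (Re z) = z"
    using weighted_measure.AE_atomD[OF weighted_measure_dS[OF assms(1)], of "\<lambda>_. True"] by auto
  then have "{t. complex_of_real t = z} = {Re z}" by auto
  then have "atom (dS S) z = measure (dS S) {Re z}" by (simp add: atom_def)
  then show ?thesis using measure_dS_singleton assms(1) by (simp add: admissible_def)
qed

context coupling
begin

lemma Jp_eq_0_iff: "Jp = 0 \<longleftrightarrow> lam \<notin> sigma_p_Q Sp" and Jm_eq_0_iff: "Jm = 0 \<longleftrightarrow> lam \<notin> sigma_p_Q Sm"
  using sigma_p_Q_iff adm_p adm_m by auto

lemma A0_case:
  assumes "lam \<in> A0 Sp \<union> A0 Sm"
  shows "lam \<notin> sigma_p_Ahat Sp Cp Sm Cm"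
proof (rule not_sigma_p)
  have np: "lam \<notin> sigma_p_Q S \<and> negmom' S lam (Suc 0) = \<infinity>" if "lam \<in> A0 S" "admissible S" for S
    using that negmom_eq_negmom'[OF that(2), of lam] by (auto simp: A0_def sigma_c_Q_def)
  show "Jp = 0 \<or> Jm = 0" unfolding Jp_eq_0_iff Jm_eq_0_iff using np assms adm_p adm_m by blast
  have "\<not> reg 0"
    unfolding negmom'_iff[symmetric] using np assms adm_p adm_m by (metis Un_iff less_irrefl)
  then show "\<not> reg 0 \<or> Jp \<noteq> 0 \<or> Jm \<noteq> 0" by blast
qed

lemma mixed_case:
  assumes "lam \<in> (Ap Sp \<inter> Ar Sm) \<union> (Ap Sm \<inter> Ar Sp)"
  shows "lam \<notin> sigma_p_Ahat Sp Cp Sm Cm"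
  by (rule not_sigma_p) (use assms in \<open>unfold Jp_eq_0_iff Jm_eq_0_iff, auto simp: Ap_def Ar_def\<close>)

lemma Ap_case:
  assumes "lam \<in> Ap Sp \<inter> Ap Sm"
  shows "lam \<in> sigma_p_Ahat Sp Cp Sm Cm" "geom_mult Sp Cp Sm Cm lam = 1"
    and "simple_eig Sp Cp Sm Cm lam \<longleftrightarrow>
      \<not> (jump Sm (Re lam) = jump Sp (Re lam) \<and> negmom' Sp lam 1 < \<infinity> \<and> negmom' Sm lam 1 < \<infinity>)"
    and "jump Sm (Re lam) = jump Sp (Re lam) \<and> negmom' Sp lam 1 < \<infinity> \<and> negmom' Sm lam 1 < \<infinity> \<Longrightarrow>
      alg_mult Sp Cp Sm Cm lam = (GREATEST k::enat. 2 \<le> k \<and>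
        (\<forall>j::nat. 2 \<le> j \<and> enat j \<le> k - 1 \<longrightarrow>
           negmom' Sp lam j < \<infinity> \<and> negmom' Sm lam j < \<infinity> \<and> vlim0 ((deriv ^^ (j - 2)) Phi) lam))"
proof -
  let ?three = "jump Sm (Re lam) = jump Sp (Re lam) \<and> negmom' Sp lam 1 < \<infinity> \<and> negmom' Sm lam 1 < \<infinity>"
  have J: "Jp \<noteq> 0" "Jm \<noteq> 0" using assms unfolding Jp_eq_0_iff Jm_eq_0_iff by (auto simp: Ap_def)
  have three: "?three \<longleftrightarrow> Jp = Jm \<and> reg 0"
    using atom_eq_jump[OF adm_p] atom_eq_jump[OF adm_m] assms negmom'_iff[of 0] by (auto simp: Ap_def)
  show s: "lam \<in> sigma_p_Ahat Sp Cp Sm Cm" "geom_mult Sp Cp Sm Cm lam = 1"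
    using sigma_p_atoms J by auto
  \<comment> \<open>The condition for extending a chain from dimension j + 2 to j + 3: the moment
    index is one ahead of \<open>Psi\<close>, because the vanishing of \<open>Psi j\<close> is
    demanded only when the next power appears.\<close>
  define C where "C = (\<lambda>j. reg (Suc j) \<and> Psi j = 0)"
  have regm: "reg m" if "reg 0" "\<forall>j<m. C j" for m
    using that by (cases m) (auto simp: C_def)
  have ge: "enat (m + 2) \<le> alg_mult Sp Cp Sm Cm lam" if "Jp = Jm" "reg 0" "\<forall>j<m. C j" for m
    using alg_mult_ge_atoms[of m] that J regm[OF that(2,3)] by (simp add: C_def)
  have le: "alg_mult Sp Cp Sm Cm lam \<le> enat (m + 2)" if "Jp = Jm" "reg 0" "\<forall>j<m. C j" "\<not> C m" for m
    using alg_mult_le_atoms[of m] that J regm[OF that(2,3)] by (simp add: C_def)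
  have two: "enat 2 \<le> alg_mult Sp Cp Sm Cm lam" if "?three"
    using ge[of 0] that[unfolded three] by (simp add: numeral_2_eq_2)
  show "simple_eig Sp Cp Sm Cm lam \<longleftrightarrow> \<not> ?three"
  proof
    assume "simple_eig Sp Cp Sm Cm lam"
    then have "\<not> enat 2 \<le> alg_mult Sp Cp Sm Cm lam" by (simp add: simple_eig_def one_enat_def)
    then show "\<not> ?three" using two by blast
  next
    assume "\<not> ?three"
    then show "simple_eig Sp Cp Sm Cm lam"
      unfolding simple_eig_def using s(1) sigma_p_atoms(3)[OF J] three by blast
  qed
  assume t: "?three"
  then have eq: "Jp = Jm" and r0: "reg 0" unfolding three by auto
  have C: "negmom' Sp lam (j + 2) < \<infinity> \<and> negmom' Sm lam (j + 2) < \<infinity> \<and> vlim0 ((deriv ^^ j) Phi) lam \<longleftrightarrow> C j" for j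
    using negmom'_iff[of "Suc j"] vlim0_iff[OF eq, of j] reg_mono[of "Suc j" j] by (auto simp: C_def)
  let ?Q = "\<lambda>k. 2 \<le> k \<and> (\<forall>j::nat. 2 \<le> j \<and> enat j \<le> k - 1 \<longrightarrow>
     negmom' Sp lam j < \<infinity> \<and> negmom' Sm lam j < \<infinity> \<and> vlim0 ((deriv ^^ (j - 2)) Phi) lam)"
  have Q: "?Q k \<longleftrightarrow> enat 2 \<le> k \<and> (\<forall>j. enat (j + 2) < k \<longrightarrow> C j)" for k
  proof -
    \<comment> \<open>For finite k the left side cannot hold when k = 0, since j + 2 > 0; for
      infinite k, k - 1 is infinite too.\<close>
    have lt: "enat (j + 2) \<le> k - 1 \<longleftrightarrow> enat (j + 2) < k" for j
      by (cases k) (auto simp: one_enat_def)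
    then show ?thesis unfolding all_ge_iff[of 2] by (simp only: C lt diff_add_inverse2 numeral_eq_enat)
  qed
  show "alg_mult Sp Cp Sm Cm lam = (GREATEST k. ?Q k)"
  proof (rule Greatest_enat_initial_segment[where C = C and s = 2 and a = 2, symmetric])
    show "enat (m + 2) \<le> alg_mult Sp Cp Sm Cm lam" if "\<forall>j<m. C j" for m
      by (rule ge[OF eq r0 that])
    show "alg_mult Sp Cp Sm Cm lam \<le> enat (m + 2)" if "\<forall>j<m. C j" "\<not> C m" for m
      by (rule le[OF eq r0 that])
  qed (rule Q, rule two[OF t])
qed

lemma Ar_case:
  assumes "lam \<in> Ar Sp \<inter> Ar Sm"
  shows "lam \<in> sigma_p_Ahat Sp Cp Sm Cm \<longleftrightarrow> vlim0 Phi lam"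
    and "lam \<in> sigma_p_Ahat Sp Cp Sm Cm \<Longrightarrow> geom_mult Sp Cp Sm Cm lam = 1"
    and "lam \<in> sigma_p_Ahat Sp Cp Sm Cm \<Longrightarrow>
      alg_mult Sp Cp Sm Cm lam = (GREATEST k::enat. 1 \<le> k \<and>
        (\<forall>j::nat. 1 \<le> j \<and> enat j \<le> k \<longrightarrow>
           negmom Sp lam j < \<infinity> \<and> negmom Sm lam j < \<infinity> \<and> vlim0 ((deriv ^^ (j - 1)) Phi) lam))"
proof -
  have J: "Jp = 0" "Jm = 0" using assms unfolding Jp_eq_0_iff Jm_eq_0_iff by (auto simp: Ar_def)
  have neg: "negmom Sp lam j = negmom' Sp lam j" "negmom Sm lam j = negmom' Sm lam j" for j
    using negmom_eq_negmom' adm_p adm_m J Jp_eq_0_iff Jm_eq_0_iff by auto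
  have r0: "reg 0" using assms negmom'_iff[of 0] neg[of "Suc 0"] by (auto simp: Ar_def)
  show 1: "lam \<in> sigma_p_Ahat Sp Cp Sm Cm \<longleftrightarrow> vlim0 Phi lam"
    using sigma_p_regular(1)[OF J r0] vlim0_iff[of 0] J r0 by simp
  assume "lam \<in> sigma_p_Ahat Sp Cp Sm Cm"
  then have P0: "Psi 0 = 0" using sigma_p_regular(1)[OF J r0] by blast
  then show "geom_mult Sp Cp Sm Cm lam = 1" using sigma_p_regular(2)[OF J r0] by blast
  \<comment> \<open>Without atoms no mass can compensate, so the moment and \<open>Psi\<close> carry
    the same index and the count starts at 0.\<close>
  define C where "C = (\<lambda>j. reg j \<and> Psi j = 0)"
  have ge: "enat (m + 0) \<le> alg_mult Sp Cp Sm Cm lam" if "\<forall>j<m. C j" for m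
    using alg_mult_ge_regular[OF J, of m] that by (simp add: C_def)
  have le: "alg_mult Sp Cp Sm Cm lam \<le> enat (m + 0)" if "\<forall>j<m. C j" "\<not> C m" for m
    using alg_mult_le_regular[OF J, of m] that by (simp add: C_def)
  have one: "enat 1 \<le> alg_mult Sp Cp Sm Cm lam" using ge[of 1] r0 P0 by (simp add: C_def)
  have C: "negmom Sp lam (Suc j) < \<infinity> \<and> negmom Sm lam (Suc j) < \<infinity> \<and> vlim0 ((deriv ^^ j) Phi) lam \<longleftrightarrow> C j" for j
    unfolding neg using negmom'_iff[of j] vlim0_iff[of j] J by (auto simp: C_def)
  let ?Q = "\<lambda>k. 1 \<le> k \<and> (\<forall>j::nat. 1 \<le> j \<and> enat j \<le> k \<longrightarrow>
     negmom Sp lam j < \<infinity> \<and> negmom Sm lam j < \<infinity> \<and> vlim0 ((deriv ^^ (j - 1)) Phi) lam)"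
  have Q: "?Q k \<longleftrightarrow> enat 1 \<le> k \<and> (\<forall>j. enat (j + 0) < k \<longrightarrow> C j)" for k
  proof -
    have "enat (j + 1) \<le> k \<longleftrightarrow> enat (j + 0) < k" for j by (simp add: Suc_ile_eq)
    then show ?thesis unfolding all_ge_iff[of 1] using C by (simp add: one_enat_def)
  qed
  show "alg_mult Sp Cp Sm Cm lam = (GREATEST k. ?Q k)"
  proof (rule Greatest_enat_initial_segment[where C = C and s = 0 and a = 1, symmetric])
    show "enat (m + 0) \<le> alg_mult Sp Cp Sm Cm lam" if "\<forall>j<m. C j" for m by (rule ge[OF that])
    show "alg_mult Sp Cp Sm Cm lam \<le> enat (m + 0)" if "\<forall>j<m. C j" "\<not> C m" for m
      by (rule le[OF that])
  qed (rule Q, rule one)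
qed

end

theorem theorem3p3:
  fixes Sp Sm :: "real \<Rightarrow> real" and Cp Cm :: real and lam :: complex
  assumes "admissible Sp" and "admissible Sm"
  defines "\<Phi> \<equiv> (\<lambda>z. M_fun Sp Cp z - M_fun Sm Cm z)"
  shows
   "(lam \<in> A0 Sp \<union> A0 Sm \<longrightarrow> lam \<notin> sigma_p_Ahat Sp Cp Sm Cm)
    \<and> (lam \<in> Ap Sp \<inter> Ap Sm \<longrightarrow>
        lam \<in> sigma_p_Ahat Sp Cp Sm Cm \<and> geom_mult Sp Cp Sm Cm lam = 1
        \<and> (simple_eig Sp Cp Sm Cm lam \<longleftrightarrow>
             \<not> (jump Sm (Re lam) = jump Sp (Re lam) \<and> negmom' Sp lam 1 < \<infinity> \<and> negmom' Sm lam 1 < \<infinity>))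
        \<and> ((jump Sm (Re lam) = jump Sp (Re lam) \<and> negmom' Sp lam 1 < \<infinity> \<and> negmom' Sm lam 1 < \<infinity>) \<longrightarrow>
             alg_mult Sp Cp Sm Cm lam =
               (GREATEST k::enat. 2 \<le> k \<and>
                  (\<forall>j::nat. 2 \<le> j \<and> enat j \<le> k - 1 \<longrightarrow>
                     negmom' Sp lam j < \<infinity> \<and> negmom' Sm lam j < \<infinity>
                     \<and> vlim0 ((deriv ^^ (j - 2)) \<Phi>) lam))))
    \<and> (lam \<in> Ar Sp \<inter> Ar Sm \<longrightarrow>
        (lam \<in> sigma_p_Ahat Sp Cp Sm Cm \<longleftrightarrow> vlim0 \<Phi> lam)
        \<and> (lam \<in> sigma_p_Ahat Sp Cp Sm Cm \<longrightarrow>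
             geom_mult Sp Cp Sm Cm lam = 1
             \<and> alg_mult Sp Cp Sm Cm lam =
               (GREATEST k::enat. 1 \<le> k \<and>
                  (\<forall>j::nat. 1 \<le> j \<and> enat j \<le> k \<longrightarrow>
                     negmom Sp lam j < \<infinity> \<and> negmom Sm lam j < \<infinity>
                     \<and> vlim0 ((deriv ^^ (j - 1)) \<Phi>) lam))))
    \<and> (lam \<in> (Ap Sp \<inter> Ar Sm) \<union> (Ap Sm \<inter> Ar Sp) \<longrightarrow> lam \<notin> sigma_p_Ahat Sp Cp Sm Cm)"
proof -
  interpret coupling Sp Sm Cp Cm lam by unfold_locales (fact assms)+
  show ?thesis unfolding \<Phi>_def
    using A0_case mixed_case Ap_case Ar_case by (intro conjI impI) assumption+
qed

end
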